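(* Let $S: z=z(u,v)$, $(u,v)\in\mathcal{D}$, be a Weingarten surface in $\mathbb{R}^3$ parameterized by natural principal parameters $(u,v)$. Then for every constant $a\neq0$ the natural PDE of $S$ is the natural PDE of the parallel surface $\bar S(a)$ of $S$; that is, the natural PDE of $\bar S(a)$, written in the same parameters $(u,v)$, for the same function $\nu$, with the Weingarten functions $\bar f,\bar g$ of $\bar S(a)$, coincides (as an equation for the unknown function $\nu$) with the natural PDE of $S$ written with the Weingarten functions $f,g$ of $S$.
   Context: Surfaces are sufficiently smooth, $S: z=z(u,v)$, $(u,v)\in\mathcal{D}$ ($\mathcal D\subset\mathbb{R}^2$ open and connected), in Euclidean $\mathbb{R}^3$, without umbilical points, parameterized by principal parameters (the coefficients of the first and second fundamental forms satisfy $F=M=0$). With unit normal $l$, the principal curvatures are $\nu_1=L/E$, $\nu_2=N/G$, and $\nu_1-\nu_2>0$. Weingarten surface: there are (sufficiently) differentiable functions $f,g$ on an interval with $f-g\neq0$, $f'g'\neq0$ and a function $\nu(u,v)$ with $(\nu_u,\nu_v)\neq(0,0)$ on $\mathcal D$ such that $\nu_1=f(\nu)$, $\nu_2=g(\nu)$; $f,g$ are called Weingarten functions. The interval may be taken to be $\nu(\mathcal D)$. Natural principal parameters: principal parameters $(u,v)$ for which the functions $\sqrt E\exp\left(\int\frac{f'd\nu}{f-g}\right)$ and $\sqrt G\exp\left(\int\frac{g'd\nu}{g-f}\right)$ (evaluated at $\nu=\nu(u,v)$) are constant. Natural PDE: with respect to natural principal parameters, fix $(u_0,v_0)\in\mathcal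 D$, put $\nu_0=\nu(u_0,v_0)$, and let $\mathfrak{a},\mathfrak{b}$ be nonzero constants with $\mathfrak{a}^2E(u_0,v_0)=1$, $\mathfrak{b}^2G(u_0,v_0)=1$. The natural PDE of the Weingarten surface is $$\mathfrak{b}^2\exp\left(2\int_{\nu_0}^{\nu}\frac{g'd\nu}{g-f}\right)\left[f'\nu_{vv}+\left(f''-\frac{2f'^2}{f-g}\right)\nu_v^2\right]-\mathfrak{a}^2\exp\left(2\int_{\nu_0}^{\nu}\frac{f'd\nu}{f-g}\right)\left[g'\nu_{uu}+\left(g''-\frac{2g'^2}{g-f}\right)\nu_u^2\right]-fg(f-g)=0.$$ Parallel surface: $\bar S(a): \bar z(u,v)=z(u,v)+a\,l(u,v)$, with the same parameters $(u,v)$, where the points with $(1-a\nu_1)(1-a\nu_2)=0$ are excluded (so $(1-a\nu_1)(1-a\nu_2)\neq0$ on the domain considered). Its unit normal is $\bar l=\varepsilon l$, $\varepsilon=\mathrm{sign}\,(1-a\nu_1)(1-a\nu_2)$. It is a Weingarten surface with the same function $\nu(u,v)$ and Weingarten functions $\bar f=\frac{\varepsilon f}{1-af}$, $\bar g=\frac{\varepsilon g}{1-ag}$, and $(u,v)$ are natural principal parameters for it as well. Its natural PDE is the equation above with $f,g,\mathfrak a,\mathfrak b$ replaced by $\bar f,\bar g,\bar{\mathfrak a},\bar{\mathfrak b}$ (same $(u_0,v_0)$ and $\nu_0$), where $\bar{\mathfrak a}^2\bar E(u_0,v_0)=1$, $\bar{\mathfrak b}^2\bar G(u_0,v_0)=1$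 and $\bar E,\bar G$ are the first fundamental form coefficients of $\bar S(a)$. Two PDE's coincide if a twice differentiable function on an open subset of the $(u,v)$-plane with values in $\nu(\mathcal D)$ satisfies one of them if and only if it satisfies the other. *)

theory Defs
  imports "HOL-Analysis.Analysis"
begin

section \<open>Partial derivatives and smoothness\<close>

definition du :: "(real \<times> real \<Rightarrow> 'a::real_normed_vector) \<Rightarrow> real \<times> real \<Rightarrow> 'a" where
  "du h p = vector_derivative (\<lambda>t. h (t, snd p)) (at (fst p))"

definition dv :: "(real \<times> real \<Rightarrow> 'a::real_normed_vector) \<Rightarrow> real \<times> real \<Rightarrow> 'a" where
  "dv h p = vector_derivative (\<lambda>t. h (fst p, t)) (at (snd p))"

text \<open>\<open>Ck_on k h U\<close>: the map \<open>h\<close> is of class \<open>C\<^sup>k\<close> on the set \<open>U\<close>, which is meant to be open.\<close>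

primrec Ck_on :: "nat \<Rightarrow> (real \<times> real \<Rightarrow> 'a::real_normed_vector) \<Rightarrow> (real \<times> real) set \<Rightarrow> bool" where
  "Ck_on 0 h U \<longleftrightarrow> continuous_on U h"
| "Ck_on (Suc k) h U \<longleftrightarrow> h differentiable_on U \<and> Ck_on k (du h) U \<and> Ck_on k (dv h) U"

definition twice_differentiable_on :: "(real \<times> real \<Rightarrow> real) \<Rightarrow> (real \<times> real) set \<Rightarrow> bool" where
  "twice_differentiable_on h U \<longleftrightarrow>
     h differentiable_on U \<and> du h differentiable_on U \<and> dv h differentiable_on U"

section \<open>Parametrized surfaces in Euclidean 3-space\<close>

definition unit_normal :: "(real \<times> real \<Rightarrow> real^3) \<Rightarrow> real \<times> real \<Rightarrow> real^3" where
  "unit_normal z p = sgn (cross3 (du z p) (dv z p))"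

definition fff_E :: "(real \<times> real \<Rightarrow> real^3) \<Rightarrow> real \<times> real \<Rightarrow> real" where
  "fff_E z p = du z p \<bullet> du z p"

definition fff_F :: "(real \<times> real \<Rightarrow> real^3) \<Rightarrow> real \<times> real \<Rightarrow> real" where
  "fff_F z p = du z p \<bullet> dv z p"

definition fff_G :: "(real \<times> real \<Rightarrow> real^3) \<Rightarrow> real \<times> real \<Rightarrow> real" where
  "fff_G z p = dv z p \<bullet> dv z p"

definition sff_L :: "(real \<times> real \<Rightarrow> real^3) \<Rightarrow> real \<times> real \<Rightarrow> real" where
  "sff_L z p = du (du z) p \<bullet> unit_normal z p"

definition sff_M :: "(real \<times> real \<Rightarrow> real^3) \<Rightarrow> real \<times> real \<Rightarrow> real" where
  "sff_M z p = dv (du z) p \<bullet> unit_normal z p"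

definition sff_N :: "(real \<times> real \<Rightarrow> real^3) \<Rightarrow> real \<times> real \<Rightarrow> real" where
  "sff_N z p = dv (dv z) p \<bullet> unit_normal z p"

definition regular_surface :: "(real \<times> real \<Rightarrow> real^3) \<Rightarrow> (real \<times> real) set \<Rightarrow> bool" where
  "regular_surface z D \<longleftrightarrow>
     open D \<and> connected D \<and> Ck_on 2 z D \<and> (\<forall>p\<in>D. cross3 (du z p) (dv z p) \<noteq> 0)"

definition principal_parameters :: "(real \<times> real \<Rightarrow> real^3) \<Rightarrow> (real \<times> real) set \<Rightarrow> bool" where
  "principal_parameters z D \<longleftrightarrow> (\<forall>p\<in>D. fff_F z p = 0 \<and> sff_M z p = 0)"

text \<open>The following are the principal curvatures only with respect to principal parameters.\<close>

definition curv1 :: "(real \<times> real \<Rightarrow> real^3) \<Rightarrow> real \<times> real \<Rightarrow> real" where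
  "curv1 z p = sff_L z p / fff_E z p"

definition curv2 :: "(real \<times> real \<Rightarrow> real^3) \<Rightarrow> real \<times> real \<Rightarrow> real" where
  "curv2 z p = sff_N z p / fff_G z p"

section \<open>Weingarten surfaces and natural principal parameters\<close>

text \<open>The Weingarten functions live on \<open>\<nu> ` D\<close>, which is an open interval because \<open>D\<close> is open
  and connected and \<open>\<nu>\<close> has no critical point. Absence of umbilical points is the strict
  inequality between the principal curvatures.\<close>

definition weingarten_surface ::
  "(real \<times> real \<Rightarrow> real^3) \<Rightarrow> (real \<times> real) set \<Rightarrow> (real \<times> real \<Rightarrow> real) \<Rightarrow>
     (real \<Rightarrow> real) \<Rightarrow> (real \<Rightarrow> real) \<Rightarrow> bool" where
  "weingarten_surface z D \<nu> f g \<longleftrightarrow>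
     regular_surface z D \<and> principal_parameters z D \<and>
     (\<forall>p\<in>D. curv1 z p - curv2 z p > 0) \<and>
     \<nu> differentiable_on D \<and> (\<forall>p\<in>D. (du \<nu> p, dv \<nu> p) \<noteq> (0, 0)) \<and>
     f differentiable_on (\<nu> ` D) \<and> deriv f differentiable_on (\<nu> ` D) \<and>
     g differentiable_on (\<nu> ` D) \<and> deriv g differentiable_on (\<nu> ` D) \<and>
     (\<forall>x\<in>\<nu> ` D. f x - g x \<noteq> 0 \<and> deriv f x * deriv g x \<noteq> 0) \<and>
     (\<forall>p\<in>D. curv1 z p = f (\<nu> p) \<and> curv2 z p = g (\<nu> p))"

text \<open>\<open>\<Phi>\<close> and \<open>\<Psi>\<close> are the indefinite integrals; they are unique up to additive constants, so it does
  not matter which ones are taken.\<close>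

definition natural_parameters ::
  "(real \<times> real \<Rightarrow> real^3) \<Rightarrow> (real \<times> real) set \<Rightarrow> (real \<times> real \<Rightarrow> real) \<Rightarrow>
     (real \<Rightarrow> real) \<Rightarrow> (real \<Rightarrow> real) \<Rightarrow> bool" where
  "natural_parameters z D \<nu> f g \<longleftrightarrow>
     (\<exists>\<Phi> \<Psi> c d.
        (\<forall>x\<in>\<nu> ` D. (\<Phi> has_real_derivative deriv f x / (f x - g x)) (at x)) \<and>
        (\<forall>x\<in>\<nu> ` D. (\<Psi> has_real_derivative deriv g x / (g x - f x)) (at x)) \<and>
        (\<forall>p\<in>D. sqrt (fff_E z p) * exp (\<Phi> (\<nu> p)) = c) \<and>
        (\<forall>p\<in>D. sqrt (fff_G z p) * exp (\<Psi> (\<nu> p)) = d))"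

section \<open>The natural PDE\<close>

text \<open>The left-hand side of the natural PDE for the unknown function \<open>h\<close> at the point \<open>p\<close>. The
  interval integral is the oriented one, so values \<open>h p < \<nu>\<^sub>0\<close> are covered.\<close>

definition natural_pde ::
  "(real \<Rightarrow> real) \<Rightarrow> (real \<Rightarrow> real) \<Rightarrow> real \<Rightarrow> real \<Rightarrow> real \<Rightarrow>
     (real \<times> real \<Rightarrow> real) \<Rightarrow> real \<times> real \<Rightarrow> real" where
  "natural_pde f g \<aa> \<bb> \<nu>\<^sub>0 h p =
     (let x = h p; f' = deriv f; g' = deriv g; f'' = deriv (deriv f); g'' = deriv (deriv g) in
      \<bb>\<^sup>2 * exp (2 * (LBINT t=\<nu>\<^sub>0..x. g' t / (g t - f t))) *
        (f' x * dv (dv h) p + (f'' x - 2 * (f' x)\<^sup>2 / (f x - g x)) * (dv h p)\<^sup>2)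
      - \<aa>\<^sup>2 * exp (2 * (LBINT t=\<nu>\<^sub>0..x. f' t / (f t - g t))) *
        (g' x * du (du h) p + (g'' x - 2 * (g' x)\<^sup>2 / (g x - f x)) * (du h p)\<^sup>2)
      - f x * g x * (f x - g x))"

definition pdes_coincide ::
  "real set \<Rightarrow> ((real \<times> real \<Rightarrow> real) \<Rightarrow> real \<times> real \<Rightarrow> real) \<Rightarrow>
     ((real \<times> real \<Rightarrow> real) \<Rightarrow> real \<times> real \<Rightarrow> real) \<Rightarrow> bool" where
  "pdes_coincide J P Q \<longleftrightarrow>
     (\<forall>U h. open U \<and> twice_differentiable_on h U \<and> h ` U \<subseteq> J \<longrightarrow>
        ((\<forall>p\<in>U. P h p = 0) \<longleftrightarrow> (\<forall>p\<in>U. Q h p = 0)))"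

section \<open>Parallel surfaces\<close>

definition parallel_surface ::
  "real \<Rightarrow> (real \<times> real \<Rightarrow> real^3) \<Rightarrow> real \<times> real \<Rightarrow> real^3" where
  "parallel_surface a z p = z p + a *\<^sub>R unit_normal z p"

text \<open>Weingarten functions of the parallel surface; the sign \<open>\<epsilon>\<close> is expressed through \<open>f\<close> and \<open>g\<close>,
  whose values along \<open>\<nu>\<close> are the principal curvatures.\<close>

definition parallel_sign :: "real \<Rightarrow> (real \<Rightarrow> real) \<Rightarrow> (real \<Rightarrow> real) \<Rightarrow> real \<Rightarrow> real" where
  "parallel_sign a f g x = sgn ((1 - a * f x) * (1 - a * g x))"

definition parallel_f :: "real \<Rightarrow> (real \<Rightarrow> real) \<Rightarrow> (real \<Rightarrow> real) \<Rightarrow> real \<Rightarrow> real" where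
  "parallel_f a f g x = parallel_sign a f g x * f x / (1 - a * f x)"

definition parallel_g :: "real \<Rightarrow> (real \<Rightarrow> real) \<Rightarrow> (real \<Rightarrow> real) \<Rightarrow> real \<Rightarrow> real" where
  "parallel_g a f g x = parallel_sign a f g x * g x / (1 - a * g x)"

end

theory Submission
  imports Defs
begin

text \<open>Since the parameters are principal, Rodrigues' formula gives \<open>l\<^sub>u = - \<nu>\<^sub>1 z\<^sub>u\<close> and
  \<open>l\<^sub>v = - \<nu>\<^sub>2 z\<^sub>v\<close>, so the passage to the parallel surface multiplies the tangent vectors by
  \<open>1 - a f\<close> and \<open>1 - a g\<close>. The antiderivatives of \<open>f' / (f - g)\<close> and \<open>g' / (g - f)\<close> change by
  \<open>- ln \<bar>1 - a f\<bar>\<close> and \<open>- ln \<bar>1 - a g\<bar>\<close>, which compensates this factor in \<open>\<surd>E\<close> and \<open>\<surd>G\<close>. In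
  the natural PDE each of the three terms is thereby multiplied by the same nowhere vanishing
  function \<open>\<epsilon> / ((1 - a f)\<^sup>2 (1 - a g)\<^sup>2)\<close> of the unknown.\<close>

section \<open>Calculus of partial derivatives\<close>

text \<open>Two obstacles shape the proof. Smoothness: the normal consumes one derivative of
  \<open>z\<close> and the parallel surface must still be of class C^2, so \<open>z\<close> is taken
  of class C^3; the off-diagonal part of Rodrigues' formula rests on equality of mixed partials. The
  sign: \<epsilon> is a function of the unknown and could jump where it is to be differentiated; it
  is constant because it is continuous with finitely many values on the connected set \<nu>(D'). The
  factor common to the three terms arises as follows. The term containing \<open>f'\<close> takes
  1/(1 - a g)^2 from its exponential and \<epsilon>/(1 - a f)^2 from its bracket, the term
  containing \<open>g'\<close> does the reverse, and the last term carries \<epsilon>^3 =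
  \<epsilon>. The lower limit of the integrals leaves constant factors, which the normalisation of
  the constants at the base point absorbs.\<close>

lemma has_vector_derivative_partials:
  fixes h :: "real \<times> real \<Rightarrow> 'a::real_normed_vector"
  assumes "(h has_derivative h') (at p)"
  shows "((\<lambda>t. h (t, snd p)) has_vector_derivative h' (1, 0)) (at (fst p))"
    and "((\<lambda>t. h (fst p, t)) has_vector_derivative h' (0, 1)) (at (snd p))"
proof -
  have lin: "linear h'"
    using assms has_derivative_linear by blast
  have "((\<lambda>t. h (t, snd p)) has_derivative (\<lambda>s. h' (s, 0))) (at (fst p))"
    by (rule has_derivative_compose[where f = "\<lambda>t. (t, snd p)" and f' = "\<lambda>s. (s, 0)"])
      (use assms in \<open>auto intro!: has_derivative_Pair\<close>)
  moreover have "(\<lambda>s. h' (s, 0)) = (\<lambda>s. s *\<^sub>R h' (1, 0))"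
  proof
    show "h' (s, 0) = s *\<^sub>R h' (1, 0)" for s
      using linear_scale[OF lin, of s "(1, 0)"] by simp
  qed
  ultimately show "((\<lambda>t. h (t, snd p)) has_vector_derivative h' (1, 0)) (at (fst p))"
    by (simp only: has_vector_derivative_def)
  have "((\<lambda>t. h (fst p, t)) has_derivative (\<lambda>s. h' (0, s))) (at (snd p))"
    by (rule has_derivative_compose[where f = "\<lambda>t. (fst p, t)" and f' = "\<lambda>s. (0, s)"])
      (use assms in \<open>auto intro!: has_derivative_Pair\<close>)
  moreover have "(\<lambda>s. h' (0, s)) = (\<lambda>s. s *\<^sub>R h' (0, 1))"
  proof
    show "h' (0, s) = s *\<^sub>R h' (0, 1)" for s
      using linear_scale[OF lin, of s "(0, 1)"] by simp
  qed
  ultimately show "((\<lambda>t. h (fst p, t)) has_vector_derivative h' (0, 1)) (at (snd p))"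
    by (simp only: has_vector_derivative_def)
qed

text \<open>\<open>vector_derivative\<close> is a choice operator, so \<open>du\<close> and
  \<open>dv\<close> are meaningful only once a derivative is exhibited. A Frechet derivative
  evaluated at the basis vectors supplies it, and the sum, product and chain rules below all reduce
  to these two equations.\<close>

lemma
  assumes "(h has_derivative h') (at p)"
  shows du_eq: "du h p = h' (1, 0)" and dv_eq: "dv h p = h' (0, 1)"
  using has_vector_derivative_partials[OF assms]
  by (auto simp: du_def dv_def intro!: vector_derivative_at)

lemma
  assumes "h differentiable (at p)"
  shows du_works: "((\<lambda>t. h (t, snd p)) has_vector_derivative du h p) (at (fst p))"
    and dv_works: "((\<lambda>t. h (fst p, t)) has_vector_derivative dv h p) (at (snd p))"
proof -
  obtain h' where h: "(h has_derivative h') (at p)"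
    using assms by (auto simp: differentiable_def)
  show "((\<lambda>t. h (t, snd p)) has_vector_derivative du h p) (at (fst p))"
    and "((\<lambda>t. h (fst p, t)) has_vector_derivative dv h p) (at (snd p))"
    by (simp_all only: du_eq[OF h] dv_eq[OF h] has_vector_derivative_partials[OF h])
qed

text \<open>Openness makes the coordinate slices of \<open>U\<close> through \<open>p\<close>
  neighbourhoods in the line. This is what permits differentiating an identity that is known on
  \<open>U\<close> only.\<close>

lemma
  assumes "open U" "p \<in> U" "\<And>q. q \<in> U \<Longrightarrow> h q = k q"
  shows du_cong: "du h p = du k p" and dv_cong: "dv h p = dv k p"
proof -
  have op: "open ((\<lambda>t. (t, snd p)) -` U)" "open ((\<lambda>t. (fst p, t)) -` U)"
    by (intro open_vimage assms(1) continuous_intros)+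
  have "\<forall>\<^sub>F t in nhds (fst p). t \<in> (\<lambda>t. (t, snd p)) -` U"
    "\<forall>\<^sub>F t in nhds (snd p). t \<in> (\<lambda>t. (fst p, t)) -` U"
    using assms(2) by (intro eventually_nhds_in_open op; simp)+
  then have "\<forall>\<^sub>F t in nhds (fst p). h (t, snd p) = k (t, snd p)"
    "\<forall>\<^sub>F t in nhds (snd p). h (fst p, t) = k (fst p, t)"
    by (auto elim!: eventually_mono simp: assms(3))
  then show "du h p = du k p" "dv h p = dv k p"
    unfolding du_def dv_def by (intro vector_derivative_cong_eq; simp)+
qed

lemma du_const [simp]: "du (\<lambda>_. c) p = 0"
  and dv_const [simp]: "dv (\<lambda>_. c) p = 0"
  by (simp_all add: du_def dv_def)

lemma
  assumes "h differentiable (at p)" "k differentiable (at p)"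
  shows du_add: "du (\<lambda>q. h q + k q) p = du h p + du k p"
    and dv_add: "dv (\<lambda>q. h q + k q) p = dv h p + dv k p"
proof -
  obtain h' k' where h: "(h has_derivative h') (at p)" and k: "(k has_derivative k') (at p)"
    using assms by (auto simp: differentiable_def)
  note * = has_derivative_add[OF h k]
  show "du (\<lambda>q. h q + k q) p = du h p + du k p" "dv (\<lambda>q. h q + k q) p = dv h p + dv k p"
    by (simp_all only: du_eq[OF *] dv_eq[OF *] du_eq[OF h] du_eq[OF k] dv_eq[OF h] dv_eq[OF k])
qed

lemma (in bounded_bilinear)
  assumes "h differentiable (at p)" "k differentiable (at p)"
  shows du_prod: "du (\<lambda>q. prod (h q) (k q)) p = prod (h p) (du k p) + prod (du h p) (k p)"
    and dv_prod: "dv (\<lambda>q. prod (h q) (k q)) p = prod (h p) (dv k p) + prod (dv h p) (k p)"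
proof -
  obtain h' k' where h: "(h has_derivative h') (at p)" and k: "(k has_derivative k') (at p)"
    using assms by (auto simp: differentiable_def)
  note * = FDERIV[OF h k]
  show "du (\<lambda>q. prod (h q) (k q)) p = prod (h p) (du k p) + prod (du h p) (k p)"
    "dv (\<lambda>q. prod (h q) (k q)) p = prod (h p) (dv k p) + prod (dv h p) (k p)"
    by (simp_all only: du_eq[OF *] dv_eq[OF *] du_eq[OF h] du_eq[OF k] dv_eq[OF h] dv_eq[OF k])
qed

lemma
  fixes h :: "real \<times> real \<Rightarrow> real"
  assumes "h differentiable (at p)" "(\<phi> has_real_derivative d) (at (h p))"
  shows du_chain: "du (\<lambda>q. \<phi> (h q)) p = d * du h p"
    and dv_chain: "dv (\<lambda>q. \<phi> (h q)) p = d * dv h p"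
proof -
  obtain h' where h: "(h has_derivative h') (at p)"
    using assms by (auto simp: differentiable_def)
  note * = has_derivative_compose[OF h assms(2)[unfolded has_field_derivative_def]]
  show "du (\<lambda>q. \<phi> (h q)) p = d * du h p" "dv (\<lambda>q. \<phi> (h q)) p = d * dv h p"
    by (simp_all only: du_eq[OF *] dv_eq[OF *] du_eq[OF h] dv_eq[OF h])
qed

lemma differentiable_onD_open:
  assumes "open U" "h differentiable_on U" "p \<in> U"
  shows "h differentiable (at p)"
  using assms by (simp add: differentiable_on_eq_differentiable_at)

section \<open>Maps of class \<open>C\<^sup>k\<close>\<close>

lemma Ck_on_cong:
  assumes "open U" "\<And>q. q \<in> U \<Longrightarrow> h q = k q" "Ck_on n h U"
  shows "Ck_on n k U"
  using assms(2,3)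
proof (induction n arbitrary: h k)
  case 0
  then show ?case
    by (simp cong: continuous_on_cong)
next
  case (Suc n)
  have diff: "k differentiable_on U"
    unfolding differentiable_on_def
  proof
    fix p assume "p \<in> U"
    then show "k differentiable (at p within U)"
      using Suc.prems by (intro differentiable_transform_within[of h p U 1 k])
        (auto simp: differentiable_on_def)
  qed
  have du: "du h q = du k q" and dv: "dv h q = dv k q" if "q \<in> U" for q
    using du_cong[OF assms(1) that Suc.prems(1)] dv_cong[OF assms(1) that Suc.prems(1)]
    by simp_all
  have "Ck_on n (du k) U" "Ck_on n (dv k) U"
    using Suc.IH[OF du] Suc.IH[OF dv] Suc.prems(2) by simp_all
  with diff show ?case by simp
qed

lemma Ck_on_Suc_imp: "Ck_on (Suc n) h U \<Longrightarrow> Ck_on n h U"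
proof (induction n arbitrary: h)
  case 0
  then show ?case by (simp add: differentiable_imp_continuous_on)
next
  case (Suc n)
  then show ?case by (metis Ck_on.simps(2))
qed

lemma Ck_on_le: "m \<le> n \<Longrightarrow> Ck_on n h U \<Longrightarrow> Ck_on m h U"
  by (induction rule: dec_induct) (blast dest: Ck_on_Suc_imp)+

lemma Ck_on_subset: "Ck_on n h U \<Longrightarrow> V \<subseteq> U \<Longrightarrow> Ck_on n h V"
  by (induction n arbitrary: h) (auto intro: continuous_on_subset differentiable_on_subset)

text \<open>\<open>Ck_on\<close> recurses on \<open>du h\<close> and \<open>dv h\<close> themselves,
  whereas formulas for them hold on \<open>U\<close> only. Trading them for their formulas here
  makes each closure property below a plain induction on the order.\<close>

lemma Ck_on_SucI:
  assumes "open U" "h differentiable_on U"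
    and "\<And>p. p \<in> U \<Longrightarrow> du h p = ku p" "\<And>p. p \<in> U \<Longrightarrow> dv h p = kv p"
    and "Ck_on n ku U" "Ck_on n kv U"
  shows "Ck_on (Suc n) h U"
  using assms(2) Ck_on_cong[OF assms(1) assms(3)[symmetric] assms(5)]
    Ck_on_cong[OF assms(1) assms(4)[symmetric] assms(6)] by simp

lemma Ck_on_const: "Ck_on n (\<lambda>_. c) U"
proof (induction n arbitrary: c)
  case (Suc n)
  have "du (\<lambda>_. c) = (\<lambda>_. 0)" "dv (\<lambda>_. c) = (\<lambda>_. 0)"
    by auto
  with Suc show ?case by simp
qed simp

lemma Ck_on_add:
  assumes "open U" "Ck_on n h U" "Ck_on n k U"
  shows "Ck_on n (\<lambda>p. h p + k p) U"
  using assms(2,3)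
proof (induction n arbitrary: h k)
  case 0
  then show ?case by (auto intro: continuous_on_add)
next
  case (Suc n)
  show ?case
  proof (rule Ck_on_SucI[OF assms(1)])
    show "du (\<lambda>p. h p + k p) p = du h p + du k p" "dv (\<lambda>p. h p + k p) p = dv h p + dv k p"
      if "p \<in> U" for p
      using Suc.prems that by (auto intro!: du_add dv_add differentiable_onD_open[OF assms(1)])
    show "(\<lambda>p. h p + k p) differentiable_on U"
      using Suc.prems by (auto intro: differentiable_on_add)
  qed (use Suc.prems in \<open>simp_all add: Suc.IH\<close>)
qed

text \<open>An abstract bilinear product lets one induction serve real multiplication, scaling,
  inner product and cross product. Each summand of the product rule keeps one factor
  undifferentiated, hence the detour through \<open>hk\<close>.\<close>

lemma (in bounded_bilinear) Ck_on_prod: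
  assumes "open U" "Ck_on n h U" "Ck_on n k U"
  shows "Ck_on n (\<lambda>p. prod (h p) (k p)) U"
  using assms(2,3)
proof (induction n arbitrary: h k)
  case 0
  then show ?case by (auto intro: continuous_on)
next
  case (Suc n)
  have hk: "Ck_on n h U" "Ck_on n k U"
    using Suc.prems Ck_on_Suc_imp by blast+
  show ?case
  proof (rule Ck_on_SucI[OF assms(1)])
    show "du (\<lambda>p. prod (h p) (k p)) p = prod (h p) (du k p) + prod (du h p) (k p)"
      "dv (\<lambda>p. prod (h p) (k p)) p = prod (h p) (dv k p) + prod (dv h p) (k p)"
      if "p \<in> U" for p
      using Suc.prems that by (auto intro!: du_prod dv_prod differentiable_onD_open[OF assms(1)])
    show "(\<lambda>p. prod (h p) (k p)) differentiable_on U"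
      unfolding differentiable_on_def
    proof
      fix p assume "p \<in> U"
      then have "h differentiable (at p within U)" "k differentiable (at p within U)"
        using Suc.prems by (simp_all add: differentiable_on_def)
      then show "(\<lambda>p. prod (h p) (k p)) differentiable (at p within U)"
        unfolding differentiable_def using FDERIV by blast
    qed
  qed (use Suc.prems hk in \<open>simp_all add: Ck_on_add assms(1) Suc.IH\<close>)
qed

lemma differentiable_on_real_compose:
  fixes h :: "'a::real_normed_vector \<Rightarrow> real"
  assumes "h differentiable_on U" "\<And>p. p \<in> U \<Longrightarrow> \<phi> differentiable (at (h p))"
  shows "(\<lambda>p. \<phi> (h p)) differentiable_on U"
  using assms unfolding differentiable_on_def
  by (blast intro: differentiable_compose[of \<phi> h] differentiable_at_withinI)

lemmas Ck_on_mult = bounded_bilinear.Ck_on_prod[OF bounded_bilinear_mult]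

text \<open>The derivative of the reciprocal is a polynomial in the reciprocal itself, so its
  smoothness of order \<open>n\<close> together with that of the partials of \<open>h\<close> yields
  order \<open>n + 1\<close>.\<close>

lemma Ck_on_inverse:
  fixes h :: "real \<times> real \<Rightarrow> real"
  assumes "open U" "Ck_on n h U" "\<And>p. p \<in> U \<Longrightarrow> h p \<noteq> 0"
  shows "Ck_on n (\<lambda>p. inverse (h p)) U"
  using assms(2)
proof (induction n)
  case 0
  then show ?case using assms(3) by (auto intro: continuous_on_inverse)
next
  case (Suc n)
  have IH: "Ck_on n (\<lambda>p. inverse (h p)) U"
    using Suc Ck_on_Suc_imp by blast
  have der: "(inverse has_real_derivative - (inverse (h p) * inverse (h p))) (at (h p))"
    if "p \<in> U" for p
    using assms(3)[OF that] by (auto intro!: derivative_eq_intros)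
  have diff: "h differentiable (at p)" if "p \<in> U" for p
    using Suc.prems that differentiable_onD_open[OF assms(1), of h] by simp
  show ?case
  proof (rule Ck_on_SucI[OF assms(1)])
    \<comment> \<open>The sign is written as a constant factor so that the product and constant
      rules alone settle the smoothness of the right-hand side.\<close>
    show "du (\<lambda>p. inverse (h p)) p = (-1 * (inverse (h p) * inverse (h p))) * du h p"
      "dv (\<lambda>p. inverse (h p)) p = (-1 * (inverse (h p) * inverse (h p))) * dv h p"
      if "p \<in> U" for p
      using du_chain[where h = h, OF diff der, OF that that]
        dv_chain[where h = h, OF diff der, OF that that] by simp_all
    show "(\<lambda>p. inverse (h p)) differentiable_on U"
    proof (rule differentiable_on_real_compose[where h = h])
      show "h differentiable_on U"
        using Suc.prems by simp
    qed (use der real_differentiable_def in blast)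
  qed (intro Ck_on_mult Ck_on_const IH assms(1); use Suc.prems in simp)+
qed

text \<open>Same bootstrap as for the reciprocal: the derivative of the root is half the reciprocal
  of the root, whose smoothness of order \<open>n\<close> follows from the induction
  hypothesis.\<close>

lemma Ck_on_sqrt:
  fixes h :: "real \<times> real \<Rightarrow> real"
  assumes "open U" "Ck_on n h U" "\<And>p. p \<in> U \<Longrightarrow> h p > 0"
  shows "Ck_on n (\<lambda>p. sqrt (h p)) U"
  using assms(2)
proof (induction n)
  case 0
  then show ?case by (auto intro: continuous_on_real_sqrt)
next
  case (Suc n)
  have "Ck_on n (\<lambda>p. sqrt (h p)) U"
    using Suc Ck_on_Suc_imp by blast
  then have IH: "Ck_on n (\<lambda>p. inverse (sqrt (h p))) U"
    by (rule Ck_on_inverse[OF assms(1)]) (use assms(3) in force)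
  have der: "(sqrt has_real_derivative inverse (sqrt (h p)) / 2) (at (h p))"
    if "p \<in> U" for p
    using DERIV_real_sqrt[OF assms(3)[OF that]] by simp
  have diff: "h differentiable (at p)" if "p \<in> U" for p
    using Suc.prems that differentiable_onD_open[OF assms(1), of h] by simp
  show ?case
  proof (rule Ck_on_SucI[OF assms(1)])
    show "du (\<lambda>p. sqrt (h p)) p = (1/2 * inverse (sqrt (h p))) * du h p"
      "dv (\<lambda>p. sqrt (h p)) p = (1/2 * inverse (sqrt (h p))) * dv h p"
      if "p \<in> U" for p
      using du_chain[where h = h, OF diff der, OF that that]
        dv_chain[where h = h, OF diff der, OF that that] by simp_all
    show "(\<lambda>p. sqrt (h p)) differentiable_on U"
    proof (rule differentiable_on_real_compose[where h = h])
      show "h differentiable_on U"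
        using Suc.prems by simp
    qed (use der real_differentiable_def in blast)
  qed (intro Ck_on_mult Ck_on_const IH assms(1); use Suc.prems in simp)+
qed

lemma Ck_on_sgn:
  fixes h :: "real \<times> real \<Rightarrow> 'a::real_inner"
  assumes "open U" "Ck_on n h U" "\<And>p. p \<in> U \<Longrightarrow> h p \<noteq> 0"
  shows "Ck_on n (\<lambda>p. sgn (h p)) U"
  unfolding sgn_div_norm norm_eq_sqrt_inner
  using assms
  by (intro bounded_bilinear.Ck_on_prod[OF bounded_bilinear_scaleR] Ck_on_inverse Ck_on_sqrt
      bounded_bilinear.Ck_on_prod[OF bounded_bilinear_inner]) auto

lemma bounded_bilinear_cross3: "bounded_bilinear cross3"
  using bilinear_cross bilinear_conv_bounded_bilinear by blast

section \<open>Symmetry of the mixed partial derivatives\<close>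

text \<open>The second difference over a square is an increment in \<open>u\<close> of an increment
  in \<open>v\<close>. The mean value theorem in \<open>u\<close>, then in \<open>v\<close>, turns
  it into a mixed partial. The companion lemma evaluates the same second difference in the opposite
  order.\<close>

lemma mixed_difference_quotient_uv:
  fixes h :: "real \<times> real \<Rightarrow> real"
  assumes "open U" "h differentiable_on U" "du h differentiable_on U"
    and "s > 0" "{u..u + s} \<times> {v..v + s} \<subseteq> U"
  obtains \<xi> \<eta> where "\<xi> \<in> {u..u + s}" "\<eta> \<in> {v..v + s}"
    "h (u + s, v + s) - h (u + s, v) - h (u, v + s) + h (u, v) = s\<^sup>2 * dv (du h) (\<xi>, \<eta>)"
proof -
  have diff: "h differentiable (at (x, y))" "du h differentiable (at (x, y))"
    if "x \<in> {u..u + s}" "y \<in> {v..v + s}" for x y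
    using assms that differentiable_onD_open by blast+
  have 1: "((\<lambda>x. h (x, v + s) - h (x, v)) has_real_derivative du h (x, v + s) - du h (x, v)) (at x)"
    if "u \<le> x" "x \<le> u + s" for x
    using du_works[OF diff(1), of x "v + s"] du_works[OF diff(1), of x v] that assms(4)
    by (auto intro!: derivative_eq_intros simp: has_real_derivative_iff_has_vector_derivative)
  obtain \<xi> where \<xi>: "u < \<xi>" "\<xi> < u + s" and
    eq1: "(h (u + s, v + s) - h (u + s, v)) - (h (u, v + s) - h (u, v))
          = s * (du h (\<xi>, v + s) - du h (\<xi>, v))"
    using MVT2[of u "u + s" "\<lambda>x. h (x, v + s) - h (x, v)" "\<lambda>x. du h (x, v + s) - du h (x, v)"]
      1 assms(4) by auto
  have 2: "((\<lambda>y. du h (\<xi>, y)) has_real_derivative dv (du h) (\<xi>, y)) (at y)"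
    if "v \<le> y" "y \<le> v + s" for y
    using dv_works[OF diff(2), of \<xi> y] that \<xi>
    by (auto simp: has_real_derivative_iff_has_vector_derivative)
  obtain \<eta> where "v < \<eta>" "\<eta> < v + s" "du h (\<xi>, v + s) - du h (\<xi>, v) = s * dv (du h) (\<xi>, \<eta>)"
    using MVT2[of v "v + s" "\<lambda>y. du h (\<xi>, y)" "\<lambda>y. dv (du h) (\<xi>, y)"] 2 assms(4) by auto
  with \<xi> eq1 show thesis
    by (intro that[of \<xi> \<eta>]) (auto simp: power2_eq_square)
qed

lemma mixed_difference_quotient_vu:
  fixes h :: "real \<times> real \<Rightarrow> real"
  assumes "open U" "h differentiable_on U" "dv h differentiable_on U"
    and "s > 0" "{u..u + s} \<times> {v..v + s} \<subseteq> U"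
  obtains \<xi> \<eta> where "\<xi> \<in> {u..u + s}" "\<eta> \<in> {v..v + s}"
    "h (u + s, v + s) - h (u + s, v) - h (u, v + s) + h (u, v) = s\<^sup>2 * du (dv h) (\<xi>, \<eta>)"
proof -
  have diff: "h differentiable (at (x, y))" "dv h differentiable (at (x, y))"
    if "x \<in> {u..u + s}" "y \<in> {v..v + s}" for x y
    using assms that differentiable_onD_open by blast+
  have 1: "((\<lambda>y. h (u + s, y) - h (u, y)) has_real_derivative dv h (u + s, y) - dv h (u, y)) (at y)"
    if "v \<le> y" "y \<le> v + s" for y
    using dv_works[OF diff(1), of "u + s" y] dv_works[OF diff(1), of u y] that assms(4)
    by (auto intro!: derivative_eq_intros simp: has_real_derivative_iff_has_vector_derivative)
  obtain \<eta> where \<eta>: "v < \<eta>" "\<eta> < v + s" and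
    eq1: "(h (u + s, v + s) - h (u, v + s)) - (h (u + s, v) - h (u, v))
          = s * (dv h (u + s, \<eta>) - dv h (u, \<eta>))"
    using MVT2[of v "v + s" "\<lambda>y. h (u + s, y) - h (u, y)" "\<lambda>y. dv h (u + s, y) - dv h (u, y)"]
      1 assms(4) by auto
  have 2: "((\<lambda>x. dv h (x, \<eta>)) has_real_derivative du (dv h) (x, \<eta>)) (at x)"
    if "u \<le> x" "x \<le> u + s" for x
    using du_works[OF diff(2), of x \<eta>] that \<eta>
    by (auto simp: has_real_derivative_iff_has_vector_derivative)
  obtain \<xi> where "u < \<xi>" "\<xi> < u + s" "dv h (u + s, \<eta>) - dv h (u, \<eta>) = s * du (dv h) (\<xi>, \<eta>)"
    using MVT2[of u "u + s" "\<lambda>x. dv h (x, \<eta>)" "\<lambda>x. du (dv h) (x, \<eta>)"] 2 assms(4) by auto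
  with \<eta> eq1 show thesis
    by (intro that[of \<xi> \<eta>]) (auto simp: power2_eq_square)
qed

lemma mixed_partials_commute_real:
  fixes h :: "real \<times> real \<Rightarrow> real"
  assumes "open U" "Ck_on 2 h U" "p \<in> U"
  shows "dv (du h) p = du (dv h) p"
proof (rule ccontr)
  assume neq: "dv (du h) p \<noteq> du (dv h) p"
  \<comment> \<open>Half the gap: values within \<open>e\<close> of the two mixed partials at
    \<open>p\<close> can never coincide.\<close>
  define e where "e = \<bar>dv (du h) p - du (dv h) p\<bar> / 2"
  have "e > 0" using neq by (simp add: e_def)
  have C: "h differentiable_on U" "du h differentiable_on U" "dv h differentiable_on U"
    "continuous_on U (dv (du h))" "continuous_on U (du (dv h))"
    using assms(2) by (auto simp: numeral_2_eq_2)
  have "isCont (dv (du h)) p" "isCont (du (dv h)) p"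
    using C(4,5) assms(1,3) by (simp_all add: continuous_on_eq_continuous_at)
  then have "(dv (du h) \<longlongrightarrow> dv (du h) p) (nhds p)" "(du (dv h) \<longlongrightarrow> du (dv h) p) (nhds p)"
    by (simp_all add: isCont_def tendsto_at_iff_tendsto_nhds)
  moreover have "\<forall>\<^sub>F q in nhds p. q \<in> U"
    using assms(1,3) by (rule eventually_nhds_in_open)
  ultimately have "\<forall>\<^sub>F q in nhds p. dist (dv (du h) q) (dv (du h) p) < e \<and>
      dist (du (dv h) q) (du (dv h) p) < e \<and> q \<in> U"
    using \<open>e > 0\<close> by (intro eventually_conj tendstoD)
  then obtain d where "d > 0" and d: "\<And>q. dist q p < d \<Longrightarrow> dist (dv (du h) q) (dv (du h) p) < e \<and>
      dist (du (dv h) q) (du (dv h) p) < e \<and> q \<in> U"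
    by (auto simp: eventually_nhds_metric)
  obtain u v where p: "p = (u, v)" by fastforce
  \<comment> \<open>A point of the square with side \<open>s\<close> and corner \<open>p\<close> is
    at distance at most 2 s < d from \<open>p\<close>.\<close>
  define s where "s = d / 3"
  have "s > 0" using \<open>d > 0\<close> by (simp add: s_def)
  have near: "dist (x, y) p < d" if "x \<in> {u..u + s}" "y \<in> {v..v + s}" for x y
  proof -
    have "dist (x, y) p \<le> \<bar>x - u\<bar> + \<bar>y - v\<bar>"
      using sqrt_sum_squares_le_sum_abs[of "x - u" "y - v"] by (simp add: p dist_Pair_Pair dist_real_def)
    also have "\<dots> \<le> s + s" using that by auto
    also have "\<dots> < d" using \<open>d > 0\<close> by (simp add: s_def)
    finally show ?thesis .
  qed
  then have sub: "{u..u + s} \<times> {v..v + s} \<subseteq> U" using d by blast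
  obtain x y where xy: "x \<in> {u..u + s}" "y \<in> {v..v + s}"
    "h (u + s, v + s) - h (u + s, v) - h (u, v + s) + h (u, v) = s\<^sup>2 * dv (du h) (x, y)"
    using mixed_difference_quotient_uv[OF assms(1) C(1,2) \<open>s > 0\<close> sub] .
  obtain x' y' where xy': "x' \<in> {u..u + s}" "y' \<in> {v..v + s}"
    "h (u + s, v + s) - h (u + s, v) - h (u, v + s) + h (u, v) = s\<^sup>2 * du (dv h) (x', y')"
    using mixed_difference_quotient_vu[OF assms(1) C(1,3) \<open>s > 0\<close> sub] .
  have "dv (du h) (x, y) = du (dv h) (x', y')"
    using xy(3) xy'(3) \<open>s > 0\<close> by simp
  then show False
    using dist_triangle_half_r[of "dv (du h) (x, y)" "dv (du h) p" "2 * e" "du (dv h) p"]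
      d[OF near[OF xy(1,2)]] d[OF near[OF xy'(1,2)]] by (simp add: e_def dist_real_def)
qed

text \<open>Pairing with a fixed vector \<open>c\<close> commutes with partial derivatives and
  reduces the claim to real functions; vectors with equal pairings against every \<open>c\<close>
  are equal. No basis enters.\<close>

lemma mixed_partials_commute:
  fixes h :: "real \<times> real \<Rightarrow> 'a::real_inner"
  assumes "open U" "Ck_on 2 h U" "p \<in> U"
  shows "dv (du h) p = du (dv h) p"
proof -
  have C: "h differentiable_on U" "du h differentiable_on U" "dv h differentiable_on U"
    using assms(2) by (auto simp: numeral_2_eq_2)
  have inner: "du (\<lambda>q. k q \<bullet> c) q = du k q \<bullet> c" "dv (\<lambda>q. k q \<bullet> c) q = dv k q \<bullet> c"
    if "k differentiable_on U" "q \<in> U" for k :: "real \<times> real \<Rightarrow> 'a" and c q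
    using bounded_bilinear.du_prod[OF bounded_bilinear_inner, of k q "\<lambda>_. c"]
      bounded_bilinear.dv_prod[OF bounded_bilinear_inner, of k q "\<lambda>_. c"]
      differentiable_onD_open[OF assms(1) that] by simp_all
  have "dv (du h) p \<bullet> c = du (dv h) p \<bullet> c" for c
  proof -
    have "dv (du h) p \<bullet> c = dv (\<lambda>q. du h q \<bullet> c) p"
      using inner C assms by simp
    also have "\<dots> = dv (du (\<lambda>q. h q \<bullet> c)) p"
      by (rule dv_cong[OF assms(1,3)]) (use inner C in simp)
    also have "\<dots> = du (dv (\<lambda>q. h q \<bullet> c)) p"
      by (rule mixed_partials_commute_real[OF assms(1) _ assms(3)])
        (auto intro!: bounded_bilinear.Ck_on_prod[OF bounded_bilinear_inner] Ck_on_const assms)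
    also have "\<dots> = du (\<lambda>q. dv h q \<bullet> c) p"
      by (rule du_cong[OF assms(1,3)]) (use inner C in simp)
    also have "\<dots> = du (dv h) p \<bullet> c"
      using inner C assms by simp
    finally show ?thesis .
  qed
  then show ?thesis
    by (metis inner_commute vector_eq_ldot)
qed

section \<open>The image of a function without critical points\<close>

lemma interior_image_of_nonzero_derivative:
  fixes \<phi> :: "real \<Rightarrow> real"
  assumes "open T" "c \<in> T" "continuous_on T \<phi>" "(\<phi> has_real_derivative l) (at c)" "l \<noteq> 0"
  shows "\<phi> c \<in> interior (\<phi> ` T)"
proof -
  obtain r where r: "r > 0" "cball c r \<subseteq> T"
    using assms(1,2) open_contains_cball by blast
  have "\<exists>t1 t2. t1 \<in> cball c r \<and> t2 \<in> cball c r \<and> \<phi> t1 < \<phi> c \<and> \<phi> c < \<phi> t2"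
  proof (cases "l > 0")
    case True
    obtain d1 d2 where "d1 > 0" "d2 > 0"
      and d1: "\<And>h. 0 < h \<Longrightarrow> h < d1 \<Longrightarrow> \<phi> c < \<phi> (c + h)"
      and d2: "\<And>h. 0 < h \<Longrightarrow> h < d2 \<Longrightarrow> \<phi> (c - h) < \<phi> c"
      using DERIV_pos_inc_right[OF assms(4) True] DERIV_pos_inc_left[OF assms(4) True] by blast
    \<comment> \<open>Halving keeps \<open>h\<close> strictly below \<open>d1\<close> and
      \<open>d2\<close>, and both points at distance \<open>h\<close> from \<open>c\<close> inside
      the closed ball.\<close>
    define h where "h = min r (min d1 d2) / 2"
    have "0 < h" "h < d1" "h < d2" "h \<le> r"
      using r \<open>d1 > 0\<close> \<open>d2 > 0\<close> by (auto simp: h_def)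
    then show ?thesis
      using d1 d2 by (intro exI[of _ "c - h"] exI[of _ "c + h"]) (simp add: dist_real_def)
  next
    case False
    then have "l < 0" using assms(5) by simp
    obtain d1 d2 where "d1 > 0" "d2 > 0"
      and d1: "\<And>h. 0 < h \<Longrightarrow> h < d1 \<Longrightarrow> \<phi> (c + h) < \<phi> c"
      and d2: "\<And>h. 0 < h \<Longrightarrow> h < d2 \<Longrightarrow> \<phi> c < \<phi> (c - h)"
      using DERIV_neg_dec_right[OF assms(4) \<open>l < 0\<close>] DERIV_neg_dec_left[OF assms(4) \<open>l < 0\<close>]
      by blast
    define h where "h = min r (min d1 d2) / 2"
    have "0 < h" "h < d1" "h < d2" "h \<le> r"
      using r \<open>d1 > 0\<close> \<open>d2 > 0\<close> by (auto simp: h_def)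
    then show ?thesis
      using d1 d2 by (intro exI[of _ "c + h"] exI[of _ "c - h"]) (simp add: dist_real_def)
  qed
  then obtain t1 t2 where t: "t1 \<in> cball c r" "t2 \<in> cball c r" "\<phi> t1 < \<phi> c" "\<phi> c < \<phi> t2"
    by blast
  have "connected (\<phi> ` cball c r)"
    using r assms(3) by (intro connected_continuous_image) (auto intro: continuous_on_subset)
  then have "{\<phi> t1..\<phi> t2} \<subseteq> \<phi> ` cball c r"
    using t by (intro connected_contains_Icc) auto
  then have "{\<phi> t1<..<\<phi> t2} \<subseteq> \<phi> ` T"
    using r(2) greaterThanLessThan_subseteq_atLeastAtMost_iff[of "\<phi> t1" "\<phi> t2" "\<phi> t1" "\<phi> t2"]
      image_mono[OF r(2), of \<phi>] by blast
  then show ?thesis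
    using t by (intro interiorI[of "{\<phi> t1<..<\<phi> t2}"]) auto
qed

text \<open>Restricting \<nu> to a coordinate line along which its partial derivative is nonzero
  reduces to one variable. Openness of the image turns differentiability of the Weingarten functions
  on it into genuine two-sided derivatives, as \<open>deriv\<close> demands.\<close>

lemma open_image_of_nonvanishing_gradient:
  fixes \<nu> :: "real \<times> real \<Rightarrow> real"
  assumes "open D" "\<nu> differentiable_on D" "\<forall>p\<in>D. (du \<nu> p, dv \<nu> p) \<noteq> (0, 0)"
  shows "open (\<nu> ` D)"
proof -
  have "\<nu> p \<in> interior (\<nu> ` D)" if p: "p \<in> D" for p
  proof -
    have diff: "\<nu> differentiable (at p)" and cont: "continuous_on D \<nu>"
      using differentiable_onD_open[OF assms(1,2) p] differentiable_imp_continuous_on[OF assms(2)]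
      by auto
    let ?Tu = "(\<lambda>t. (t, snd p)) -` D" and ?Tv = "(\<lambda>t. (fst p, t)) -` D"
    have op: "open ?Tu" "open ?Tv"
      by (intro open_vimage assms(1) continuous_intros)+
    have "continuous_on ?Tu (\<lambda>t. \<nu> (t, snd p))" "continuous_on ?Tv (\<lambda>t. \<nu> (fst p, t))"
      by (rule continuous_on_compose2[OF cont]; auto intro!: continuous_intros)+
    then have "du \<nu> p \<noteq> 0 \<Longrightarrow> \<nu> p \<in> interior ((\<lambda>t. \<nu> (t, snd p)) ` ?Tu)"
      "dv \<nu> p \<noteq> 0 \<Longrightarrow> \<nu> p \<in> interior ((\<lambda>t. \<nu> (fst p, t)) ` ?Tv)"
      using interior_image_of_nonzero_derivative[OF op(1), of "fst p" "\<lambda>t. \<nu> (t, snd p)" "du \<nu> p"]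
        interior_image_of_nonzero_derivative[OF op(2), of "snd p" "\<lambda>t. \<nu> (fst p, t)" "dv \<nu> p"]
        du_works[OF diff] dv_works[OF diff] p
      by (simp_all add: has_real_derivative_iff_has_vector_derivative)
    moreover have "interior ((\<lambda>t. \<nu> (t, snd p)) ` ?Tu) \<subseteq> interior (\<nu> ` D)"
      "interior ((\<lambda>t. \<nu> (fst p, t)) ` ?Tv) \<subseteq> interior (\<nu> ` D)"
      by (intro interior_mono; blast)+
    ultimately show ?thesis
      using assms(3) p by auto
  qed
  then show ?thesis
    by (metis image_subsetI interior_subset interior_eq subset_antisym)
qed

section \<open>Principal parameters and parallel surfaces\<close>

text \<open>The product rule applied to a constant inner product shifts the derivative to the other
  factor. It will be used for the unit length of the normal and for the orthogonality of tangent
  vectors to it.\<close>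

lemma
  fixes h k :: "real \<times> real \<Rightarrow> 'a::real_inner"
  assumes "open U" "p \<in> U" "h differentiable_on U" "k differentiable_on U"
    and const: "\<And>q. q \<in> U \<Longrightarrow> h q \<bullet> k q = c"
  shows du_inner_const: "du h p \<bullet> k p = - (h p \<bullet> du k p)"
    and dv_inner_const: "dv h p \<bullet> k p = - (h p \<bullet> dv k p)"
proof -
  have "h differentiable (at p)" "k differentiable (at p)"
    using differentiable_onD_open assms by blast+
  then have "du (\<lambda>q. h q \<bullet> k q) p = h p \<bullet> du k p + du h p \<bullet> k p"
    "dv (\<lambda>q. h q \<bullet> k q) p = h p \<bullet> dv k p + dv h p \<bullet> k p"
    by (simp_all add: bounded_bilinear.du_prod[OF bounded_bilinear_inner]
        bounded_bilinear.dv_prod[OF bounded_bilinear_inner])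
  moreover have "du (\<lambda>q. h q \<bullet> k q) p = 0" "dv (\<lambda>q. h q \<bullet> k q) p = 0"
    using du_cong[OF assms(1,2) const] dv_cong[OF assms(1,2) const] by simp_all
  ultimately show "du h p \<bullet> k p = - (h p \<bullet> du k p)" "dv h p \<bullet> k p = - (h p \<bullet> dv k p)"
    by linarith+
qed

text \<open>Subtracting the projections onto \<open>x\<close> and \<open>y\<close> leaves a
  remainder orthogonal to both; by Lagrange's formula its cross product with the normal direction
  vanishes. It is also orthogonal to that nonzero direction, so it is zero.\<close>

lemma orthogonal_to_cross3_expansion:
  fixes x y w :: "real^3"
  assumes "x \<bullet> y = 0" "cross3 x y \<noteq> 0" "w \<bullet> cross3 x y = 0"
  shows "w = (w \<bullet> x / (x \<bullet> x)) *\<^sub>R x + (w \<bullet> y / (y \<bullet> y)) *\<^sub>R y"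
proof -
  define r where "r = w - (w \<bullet> x / (x \<bullet> x)) *\<^sub>R x - (w \<bullet> y / (y \<bullet> y)) *\<^sub>R y"
  have "x \<noteq> 0" "y \<noteq> 0" using assms(2) by auto
  then have "r \<bullet> x = 0" "r \<bullet> y = 0"
    using assms(1) by (simp_all add: r_def inner_diff_left inner_commute[of y x])
  then have "cross3 r (cross3 x y) = 0"
    by (simp add: Lagrange)
  moreover have "r \<bullet> cross3 x y = 0"
    using assms(3) by (simp add: r_def inner_diff_left dot_cross_self)
  ultimately have "norm r * norm (cross3 x y) = 0"
    using norm_cross_dot[of r "cross3 x y"] by simp
  with assms(2) show ?thesis
    by (simp add: r_def algebra_simps)
qed

lemma Ck_on_unit_normal:
  assumes "open U" "Ck_on (Suc n) z U" "\<And>p. p \<in> U \<Longrightarrow> cross3 (du z p) (dv z p) \<noteq> 0"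
  shows "Ck_on n (unit_normal z) U"
proof -
  have "Ck_on n (\<lambda>p. sgn (cross3 (du z p) (dv z p))) U"
    using assms
    by (intro Ck_on_sgn bounded_bilinear.Ck_on_prod[OF bounded_bilinear_cross3]) auto
  then show ?thesis
    by (simp add: unit_normal_def[abs_def])
qed

lemma inner_unit_normal:
  "du z p \<bullet> unit_normal z p = 0" "dv z p \<bullet> unit_normal z p = 0"
  by (simp_all add: unit_normal_def sgn_div_norm dot_cross_self)

lemma
  assumes "cross3 (du z p) (dv z p) \<noteq> 0"
  shows inner_unit_normal_self: "unit_normal z p \<bullet> unit_normal z p = 1"
    and fff_E_pos: "fff_E z p > 0" and fff_G_pos: "fff_G z p > 0"
proof -
  show "unit_normal z p \<bullet> unit_normal z p = 1"
    using assms by (simp add: unit_normal_def dot_square_norm norm_sgn)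
  have "du z p \<noteq> 0" "dv z p \<noteq> 0" using assms by auto
  then show "fff_E z p > 0" "fff_G z p > 0" by (simp_all add: fff_E_def fff_G_def)
qed

locale principal_surface =
  fixes z :: "real \<times> real \<Rightarrow> real^3" and D :: "(real \<times> real) set"
  assumes open_D: "open D" and C3: "Ck_on 3 z D"
    and regular: "p \<in> D \<Longrightarrow> cross3 (du z p) (dv z p) \<noteq> 0"
    and principal: "p \<in> D \<Longrightarrow> fff_F z p = 0" "p \<in> D \<Longrightarrow> sff_M z p = 0"
begin

lemma z_differentiable:
  "z differentiable_on D" "du z differentiable_on D" "dv z differentiable_on D"
  using C3 by (simp_all add: numeral_3_eq_3)

lemma unit_normal_C2: "Ck_on 2 (unit_normal z) D"
  using C3 by (intro Ck_on_unit_normal open_D regular) (simp_all add: numeral_3_eq_3)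

lemma unit_normal_differentiable: "unit_normal z differentiable_on D"
  using unit_normal_C2 by (simp add: numeral_2_eq_2)

lemma sff_eq:
  assumes "p \<in> D"
  shows "sff_L z p = curv1 z p * fff_E z p" "sff_N z p = curv2 z p * fff_G z p"
  using fff_E_pos[OF regular[OF assms]] fff_G_pos[OF regular[OF assms]]
  by (simp_all add: curv1_def curv2_def)

text \<open>Rodrigues' formula. Unit length makes the derivatives of the normal tangential;
  differentiating the orthogonality of \<open>du z\<close> and \<open>dv z\<close> to the normal
  gives their tangential components as negated second form coefficients, and the mixed ones vanish
  for principal parameters.\<close>

lemma
  assumes p: "p \<in> D"
  shows du_unit_normal: "du (unit_normal z) p = - curv1 z p *\<^sub>R du z p"
    and dv_unit_normal: "dv (unit_normal z) p = - curv2 z p *\<^sub>R dv z p"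
proof -
  let ?l = "unit_normal z"
  note l = unit_normal_differentiable and z = z_differentiable
  have "du ?l p \<bullet> ?l p = - (?l p \<bullet> du ?l p)" "dv ?l p \<bullet> ?l p = - (?l p \<bullet> dv ?l p)"
    using du_inner_const[OF open_D p l l inner_unit_normal_self]
      dv_inner_const[OF open_D p l l inner_unit_normal_self] regular by auto
  then have ll: "du ?l p \<bullet> ?l p = 0" "dv ?l p \<bullet> ?l p = 0"
    by (simp_all add: inner_commute)
  have "?l p = (1 / norm (cross3 (du z p) (dv z p))) *\<^sub>R cross3 (du z p) (dv z p)"
    by (simp add: unit_normal_def sgn_div_norm divide_inverse)
  with ll regular[OF p] have tang: "du ?l p \<bullet> cross3 (du z p) (dv z p) = 0"
    "dv ?l p \<bullet> cross3 (du z p) (dv z p) = 0"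
    by simp_all
  \<comment> \<open>\<open>sff_M\<close> is defined through \<open>dv (du z)\<close>, but the
    component of \<open>du ?l\<close> along \<open>dv z\<close> produces
    \<open>du (dv z)\<close>.\<close>
  have sym: "dv (du z) p = du (dv z) p"
    by (rule mixed_partials_commute[OF open_D Ck_on_le[OF _ C3] p]) simp
  have "du ?l p \<bullet> du z p = - sff_L z p" "dv ?l p \<bullet> du z p = - sff_M z p"
    using du_inner_const[OF open_D p z(2) l inner_unit_normal(1)]
      dv_inner_const[OF open_D p z(2) l inner_unit_normal(1)]
    by (simp_all add: sff_L_def sff_M_def inner_commute)
  moreover have "du ?l p \<bullet> dv z p = - sff_M z p" "dv ?l p \<bullet> dv z p = - sff_N z p"
    using du_inner_const[OF open_D p z(3) l inner_unit_normal(2)]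
      dv_inner_const[OF open_D p z(3) l inner_unit_normal(2)]
    by (simp_all add: sff_M_def sff_N_def inner_commute sym)
  moreover note exp = orthogonal_to_cross3_expansion[OF _ regular[OF p]]
  ultimately show "du ?l p = - curv1 z p *\<^sub>R du z p" "dv ?l p = - curv2 z p *\<^sub>R dv z p"
    using exp[OF _ tang(1)] exp[OF _ tang(2)] principal[OF p]
    by (simp_all add: fff_F_def curv1_def curv2_def fff_E_def fff_G_def)
qed

section \<open>The fundamental forms and principal curvatures of the parallel surface\<close>

lemma
  assumes p: "p \<in> D"
  shows du_parallel_surface: "du (parallel_surface a z) p = (1 - a * curv1 z p) *\<^sub>R du z p"
    and dv_parallel_surface: "dv (parallel_surface a z) p = (1 - a * curv2 z p) *\<^sub>R dv z p"
proof -
  have z: "z differentiable (at p)" and l: "unit_normal z differentiable (at p)"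
    using differentiable_onD_open[OF open_D _ p] z_differentiable(1) unit_normal_differentiable
    by auto
  have a: "(\<lambda>_. a) differentiable (at p)" by simp
  have al: "(\<lambda>q. a *\<^sub>R unit_normal z q) differentiable (at p)"
    using l by simp
  note scaleR = bounded_bilinear_scaleR
  have eq: "parallel_surface a z = (\<lambda>q. z q + a *\<^sub>R unit_normal z q)"
    by (simp add: parallel_surface_def fun_eq_iff)
  show "du (parallel_surface a z) p = (1 - a * curv1 z p) *\<^sub>R du z p"
    unfolding eq du_add[OF z al] bounded_bilinear.du_prod[OF scaleR a l] du_unit_normal[OF p]
    by (simp add: algebra_simps)
  show "dv (parallel_surface a z) p = (1 - a * curv2 z p) *\<^sub>R dv z p"
    unfolding eq dv_add[OF z al] bounded_bilinear.dv_prod[OF scaleR a l] dv_unit_normal[OF p]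
    by (simp add: algebra_simps)
qed

lemma parallel_surface_C2: "Ck_on 2 (parallel_surface a z) D"
proof -
  have "Ck_on 2 (\<lambda>q. z q + a *\<^sub>R unit_normal z q) D"
    by (intro Ck_on_add bounded_bilinear.Ck_on_prod[OF bounded_bilinear_scaleR] Ck_on_const
        unit_normal_C2 open_D Ck_on_le[OF _ C3]) simp
  then show ?thesis
    by (simp add: parallel_surface_def[abs_def])
qed

lemma cross3_parallel_surface:
  assumes "p \<in> D"
  shows "cross3 (du (parallel_surface a z) p) (dv (parallel_surface a z) p) =
    ((1 - a * curv1 z p) * (1 - a * curv2 z p)) *\<^sub>R cross3 (du z p) (dv z p)"
  using assms by (simp add: du_parallel_surface dv_parallel_surface cross_mult_left cross_mult_right)

lemma unit_normal_parallel_surface: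
  assumes "p \<in> D"
  shows "unit_normal (parallel_surface a z) p =
    sgn ((1 - a * curv1 z p) * (1 - a * curv2 z p)) *\<^sub>R unit_normal z p"
  using cross3_parallel_surface[OF assms] by (simp add: unit_normal_def sgn_scaleR)

lemma fff_parallel_surface:
  assumes "p \<in> D"
  shows "fff_E (parallel_surface a z) p = (1 - a * curv1 z p)\<^sup>2 * fff_E z p"
    "fff_F (parallel_surface a z) p = 0"
    "fff_G (parallel_surface a z) p = (1 - a * curv2 z p)\<^sup>2 * fff_G z p"
  using assms principal(1)[OF assms]
  by (simp_all add: fff_E_def fff_F_def fff_G_def du_parallel_surface dv_parallel_surface
      power2_eq_square)

text \<open>The tangent vectors of the parallel surface stay orthogonal to the normal of \<open>z\<close>, so its
  second fundamental form comes from the derivative of the normal alone, and the derivatives of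
  the principal curvatures do not enter.\<close>

lemma sff_parallel_surface:
  fixes a defines "\<epsilon> \<equiv> \<lambda>p. sgn ((1 - a * curv1 z p) * (1 - a * curv2 z p))"
  assumes p: "p \<in> D"
  shows "sff_L (parallel_surface a z) p = \<epsilon> p * (1 - a * curv1 z p) * sff_L z p"
    "sff_M (parallel_surface a z) p = 0"
    "sff_N (parallel_surface a z) p = \<epsilon> p * (1 - a * curv2 z p) * sff_N z p"
proof -
  let ?y = "parallel_surface a z"
  note l = unit_normal_differentiable
  have y: "du ?y differentiable_on D" "dv ?y differentiable_on D"
    using parallel_surface_C2[of a] by (auto simp: numeral_2_eq_2)
  have orth: "du ?y q \<bullet> unit_normal z q = 0" "dv ?y q \<bullet> unit_normal z q = 0" if "q \<in> D" for q
    using that by (simp_all add: du_parallel_surface dv_parallel_surface inner_unit_normal)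
  have "du (du ?y) p \<bullet> unit_normal z p = (1 - a * curv1 z p) * sff_L z p"
    "dv (du ?y) p \<bullet> unit_normal z p = 0"
    using du_inner_const[OF open_D p y(1) l orth(1)] dv_inner_const[OF open_D p y(1) l orth(1)]
      principal(1)[OF p] p
    by (simp_all add: du_unit_normal dv_unit_normal du_parallel_surface sff_eq fff_E_def fff_F_def)
  then show "sff_L ?y p = \<epsilon> p * (1 - a * curv1 z p) * sff_L z p" "sff_M ?y p = 0"
    using p by (simp_all add: sff_L_def[of ?y] sff_M_def[of ?y] unit_normal_parallel_surface \<epsilon>_def)
  have "dv (dv ?y) p \<bullet> unit_normal z p = (1 - a * curv2 z p) * sff_N z p"
    using dv_inner_const[OF open_D p y(2) l orth(2)] p
    by (simp add: dv_unit_normal dv_parallel_surface sff_eq fff_G_def)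
  then show "sff_N ?y p = \<epsilon> p * (1 - a * curv2 z p) * sff_N z p"
    using p by (simp add: sff_N_def[of ?y] unit_normal_parallel_surface \<epsilon>_def)
qed

lemma curv_parallel_surface:
  assumes p: "p \<in> D" and "(1 - a * curv1 z p) * (1 - a * curv2 z p) \<noteq> 0"
  shows "curv1 (parallel_surface a z) p =
      sgn ((1 - a * curv1 z p) * (1 - a * curv2 z p)) * curv1 z p / (1 - a * curv1 z p)"
    "curv2 (parallel_surface a z) p =
      sgn ((1 - a * curv1 z p) * (1 - a * curv2 z p)) * curv2 z p / (1 - a * curv2 z p)"
  using assms
  by (simp_all add: curv1_def[of "parallel_surface a z"] curv2_def[of "parallel_surface a z"]
      fff_parallel_surface sff_parallel_surface sff_eq power2_eq_square
      fff_E_pos[OF regular[OF p]] fff_G_pos[OF regular[OF p]] less_imp_neq[symmetric])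

end

section \<open>Weingarten functions of a parallel surface\<close>

text \<open>Evenness of \<open>ln\<close> carries the derivative over to the negative axis. Negative
  arguments do occur, since 1 - a f may have either sign.\<close>

lemma DERIV_ln_nonzero:
  fixes x :: real
  assumes "x \<noteq> 0"
  shows "(ln has_real_derivative 1 / x) (at x)"
proof (cases "x > 0")
  case True
  then show ?thesis by (rule DERIV_ln_divide)
next
  case False
  then have "((\<lambda>x. ln (- x)) has_real_derivative 1 / x) (at x)"
    using assms by (auto intro!: derivative_eq_intros)
  then show ?thesis by (simp add: ln_minus)
qed

text \<open>Connectedness keeps the whole segment between the limits in \<open>J\<close>, whichever
  limit is the larger.\<close>

lemma interval_integral_antiderivative:
  fixes \<Phi> \<phi> :: "real \<Rightarrow> real"
  assumes "connected J" "x\<^sub>0 \<in> J" "x \<in> J" "continuous_on J \<phi>"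
    and "\<And>t. t \<in> J \<Longrightarrow> (\<Phi> has_real_derivative \<phi> t) (at t)"
  shows "(LBINT t=x\<^sub>0..x. \<phi> t) = \<Phi> x - \<Phi> x\<^sub>0"
proof (rule interval_integral_FTC_finite)
  have sub: "{min x\<^sub>0 x..max x\<^sub>0 x} \<subseteq> J"
    using assms(1-3) by (intro connected_contains_Icc) (auto simp: min_def max_def)
  then show "continuous_on {min x\<^sub>0 x..max x\<^sub>0 x} \<phi>"
    using assms(4) continuous_on_subset by blast
  show "(\<Phi> has_vector_derivative \<phi> t) (at t within {min x\<^sub>0 x..max x\<^sub>0 x})"
    if "min x\<^sub>0 x \<le> t" "t \<le> max x\<^sub>0 x" for t
  proof -
    have "t \<in> J" using sub that by auto
    then show ?thesis
      using assms(5) has_vector_derivative_at_within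
      unfolding has_real_derivative_iff_has_vector_derivative by blast
  qed
qed

lemma parallel_sign_swap: "parallel_sign a g f = parallel_sign a f g"
  by (simp add: parallel_sign_def fun_eq_iff mult.commute)

lemma parallel_f_swap: "parallel_f a g f = parallel_g a f g"
  and parallel_g_swap: "parallel_g a g f = parallel_f a f g"
  by (simp_all add: parallel_f_def parallel_g_def parallel_sign_swap fun_eq_iff)

locale weingarten_functions =
  fixes a :: real and f g :: "real \<Rightarrow> real" and J :: "real set"
  assumes open_J: "open J" and connected_J: "connected J"
    and f_diff: "f differentiable_on J" "deriv f differentiable_on J"
    and g_diff: "g differentiable_on J" "deriv g differentiable_on J"
    and fg: "x \<in> J \<Longrightarrow> f x \<noteq> g x"
    and nonfocal: "x \<in> J \<Longrightarrow> 1 - a * f x \<noteq> 0" "x \<in> J \<Longrightarrow> 1 - a * g x \<noteq> 0"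
begin

text \<open>The locale is symmetric in the two functions and so is the sign. Every fact proved for
  the first function therefore yields its counterpart for the second by instantiation.\<close>

lemma swapped: "weingarten_functions a g f J"
  by unfold_locales
    (use open_J connected_J f_diff g_diff fg[symmetric] nonfocal in blast)+

lemma f_deriv:
  assumes "x \<in> J"
  shows "(f has_real_derivative deriv f x) (at x)"
    "(deriv f has_real_derivative deriv (deriv f) x) (at x)"
  using differentiable_onD_open[OF open_J f_diff(1) assms]
    differentiable_onD_open[OF open_J f_diff(2) assms]
  by (simp_all add: DERIV_deriv_iff_real_differentiable)

lemma parallel_sign_cases:
  assumes "x \<in> J" shows "parallel_sign a f g x = 1 \<or> parallel_sign a f g x = -1"
  using nonfocal[OF assms] by (simp add: parallel_sign_def sgn_real_def)

lemma parallel_sign_constant: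
  assumes "x \<in> J" "y \<in> J"
  shows "parallel_sign a f g x = parallel_sign a f g y"
proof -
  have "continuous_on J (\<lambda>x. sgn ((1 - a * f x) * (1 - a * g x)))"
    using f_diff(1) g_diff(1) nonfocal
    by (intro continuous_intros differentiable_imp_continuous_on) auto
  moreover have "finite ((\<lambda>x. sgn ((1 - a * f x) * (1 - a * g x))) ` J)"
    by (rule finite_subset[of _ "{-1, 0, 1::real}"]) (auto simp: sgn_real_def)
  ultimately have "(\<lambda>x. sgn ((1 - a * f x) * (1 - a * g x))) constant_on J"
    using connected_J continuous_finite_range_constant by blast
  then show ?thesis
    using assms by (auto simp: constant_on_def parallel_sign_def)
qed

text \<open>Near \<open>x\<close> the sign may be frozen at its value there, after which this is the
  quotient rule for y / (1 - a y): the terms with a f f' in the numerator cancel.\<close>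

lemma parallel_f_has_derivative:
  assumes "x \<in> J"
  shows "(parallel_f a f g has_real_derivative
    parallel_sign a f g x * deriv f x / (1 - a * f x)\<^sup>2) (at x)"
proof (rule has_field_derivative_transform_within_open[OF _ open_J assms])
  show "((\<lambda>y. parallel_sign a f g x * f y / (1 - a * f y)) has_real_derivative
      parallel_sign a f g x * deriv f x / (1 - a * f x)\<^sup>2) (at x)"
  proof (rule DERIV_cong)
    have "((\<lambda>y. 1 - a * f y) has_real_derivative - (a * deriv f x)) (at x)"
      using f_deriv(1)[OF assms] by (auto intro!: derivative_eq_intros)
    then show "((\<lambda>y. parallel_sign a f g x * f y / (1 - a * f y)) has_real_derivative
        (parallel_sign a f g x * deriv f x * (1 - a * f x) -
          parallel_sign a f g x * f x * - (a * deriv f x)) / ((1 - a * f x) * (1 - a * f x))) (at x)"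
      using nonfocal(1)[OF assms] by (intro DERIV_divide DERIV_cmult f_deriv(1)[OF assms]) simp
    have "parallel_sign a f g x * deriv f x * (1 - a * f x) -
        parallel_sign a f g x * f x * - (a * deriv f x) = parallel_sign a f g x * deriv f x"
      by (simp add: algebra_simps)
    then show "(parallel_sign a f g x * deriv f x * (1 - a * f x) -
          parallel_sign a f g x * f x * - (a * deriv f x)) / ((1 - a * f x) * (1 - a * f x)) =
        parallel_sign a f g x * deriv f x / (1 - a * f x)\<^sup>2"
      by (simp add: power2_eq_square)
  qed
  show "parallel_sign a f g x * f y / (1 - a * f y) = parallel_f a f g y" if "y \<in> J" for y
    unfolding parallel_f_def parallel_sign_constant[OF that assms] ..
qed

lemma deriv_parallel_f:
  "x \<in> J \<Longrightarrow> deriv (parallel_f a f g) x = parallel_sign a f g x * deriv f x / (1 - a * f x)\<^sup>2"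
  using parallel_f_has_derivative DERIV_imp_deriv by blast

lemma deriv_parallel_f_has_derivative:
  assumes "x \<in> J"
  shows "(deriv (parallel_f a f g) has_real_derivative parallel_sign a f g x *
    (deriv (deriv f) x / (1 - a * f x)\<^sup>2 + 2 * a * (deriv f x)\<^sup>2 / (1 - a * f x) ^ 3)) (at x)"
proof (rule has_field_derivative_transform_within_open[OF _ open_J assms])
  define m where "m = 1 - a * f x"
  have "m \<noteq> 0" using nonfocal(1)[OF assms] by (simp add: m_def)
  have "((\<lambda>y. 1 - a * f y) has_real_derivative - (a * deriv f x)) (at x)"
    using f_deriv(1)[OF assms] by (auto intro!: derivative_eq_intros)
  from DERIV_power[OF this, of 2]
  have "((\<lambda>y. (1 - a * f y)\<^sup>2) has_real_derivative - (2 * a * m * deriv f x)) (at x)"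
    by (simp add: m_def algebra_simps)
  then have "((\<lambda>y. parallel_sign a f g x * deriv f y / (1 - a * f y)\<^sup>2) has_real_derivative
      (parallel_sign a f g x * deriv (deriv f) x * m\<^sup>2 -
        parallel_sign a f g x * deriv f x * - (2 * a * m * deriv f x)) / (m\<^sup>2 * m\<^sup>2)) (at x)"
    using \<open>m \<noteq> 0\<close> unfolding m_def by (intro DERIV_divide DERIV_cmult f_deriv(2)[OF assms] power_not_zero)
  moreover have "(parallel_sign a f g x * deriv (deriv f) x * m\<^sup>2 -
        parallel_sign a f g x * deriv f x * - (2 * a * m * deriv f x)) / (m\<^sup>2 * m\<^sup>2) =
      parallel_sign a f g x * (deriv (deriv f) x / m\<^sup>2 + 2 * a * (deriv f x)\<^sup>2 / m ^ 3)"
    using \<open>m \<noteq> 0\<close> by (simp add: field_simps power2_eq_square power3_eq_cube)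
  ultimately show "((\<lambda>y. parallel_sign a f g x * deriv f y / (1 - a * f y)\<^sup>2) has_real_derivative
      parallel_sign a f g x *
      (deriv (deriv f) x / (1 - a * f x)\<^sup>2 + 2 * a * (deriv f x)\<^sup>2 / (1 - a * f x) ^ 3)) (at x)"
    by (simp only: m_def)
  show "parallel_sign a f g x * deriv f y / (1 - a * f y)\<^sup>2 = deriv (parallel_f a f g) y"
    if "y \<in> J" for y
    unfolding deriv_parallel_f[OF that] parallel_sign_constant[OF that assms] ..
qed

lemma deriv2_parallel_f:
  "x \<in> J \<Longrightarrow> deriv (deriv (parallel_f a f g)) x = parallel_sign a f g x *
    (deriv (deriv f) x / (1 - a * f x)\<^sup>2 + 2 * a * (deriv f x)\<^sup>2 / (1 - a * f x) ^ 3)"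
  using deriv_parallel_f_has_derivative DERIV_imp_deriv by blast

lemma parallel_f_diff:
  "parallel_f a f g differentiable_on J" "deriv (parallel_f a f g) differentiable_on J"
  unfolding differentiable_on_def using parallel_f_has_derivative deriv_parallel_f_has_derivative
  by (meson differentiable_at_withinI real_differentiable_def)+

lemma parallel_f_minus_parallel_g:
  assumes "x \<in> J"
  shows "parallel_f a f g x - parallel_g a f g x =
    parallel_sign a f g x * (f x - g x) / ((1 - a * f x) * (1 - a * g x))"
proof -
  define m n where "m = 1 - a * f x" and "n = 1 - a * g x"
  have nz: "m \<noteq> 0" "n \<noteq> 0" using nonfocal[OF assms] by (simp_all add: m_def n_def)
  have "f x * n - g x * m = f x - g x" by (simp add: m_def n_def algebra_simps)
  then have "f x / m - g x / n = (f x - g x) / (m * n)"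
    using nz by (simp add: diff_frac_eq)
  then show ?thesis
    unfolding parallel_f_def parallel_g_def m_def n_def
    by (metis right_diff_distrib times_divide_eq_right)
qed

lemma integrand_parallel_f:
  assumes "x \<in> J"
  shows "deriv (parallel_f a f g) x / (parallel_f a f g x - parallel_g a f g x) =
    deriv f x / (f x - g x) + a * deriv f x / (1 - a * f x)"
proof -
  define s m n d where "s = parallel_sign a f g x" and "m = 1 - a * f x" and "n = 1 - a * g x"
    and "d = f x - g x"
  have nz: "m \<noteq> 0" "n \<noteq> 0" "d \<noteq> 0" "s \<noteq> 0"
    using nonfocal[OF assms] fg[OF assms] parallel_sign_cases[OF assms]
    by (auto simp: s_def m_def n_def d_def)
  \<comment> \<open>Writing 1 - a g as (1 - a f) + a (f - g) splits the quotient into the old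
    integrand and the logarithmic derivative of 1 / (1 - a f).\<close>
  have n: "n = m + a * d" by (simp add: m_def n_def d_def algebra_simps)
  have "(s * deriv f x / m\<^sup>2) / (s * d / (m * n)) = deriv f x * n / (d * m)"
    using nz by (simp add: divide_simps power2_eq_square)
  also have "\<dots> = deriv f x / d + a * deriv f x / m"
    unfolding n using nz by (simp add: field_simps)
  finally show ?thesis
    unfolding deriv_parallel_f[OF assms] parallel_f_minus_parallel_g[OF assms]
    by (simp only: s_def m_def n_def d_def)
qed

text \<open>The real logarithm of Isabelle is even, so no absolute value is needed below.\<close>

lemma antiderivative_parallel_f:
  assumes "x \<in> J" "(\<Phi> has_real_derivative deriv f x / (f x - g x)) (at x)"
  shows "((\<lambda>x. \<Phi> x - ln (1 - a * f x)) has_real_derivative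
    deriv (parallel_f a f g) x / (parallel_f a f g x - parallel_g a f g x)) (at x)"
proof -
  have nz: "1 - a * f x \<noteq> 0" using nonfocal[OF assms(1)] by simp
  have "((\<lambda>x. 1 - a * f x) has_real_derivative - (a * deriv f x)) (at x)"
    using f_deriv[OF assms(1)] by (auto intro!: derivative_eq_intros)
  from DERIV_diff[OF assms(2) DERIV_chain2[OF DERIV_ln_nonzero[OF nz] this]]
  show ?thesis
    by (simp add: integrand_parallel_f[OF assms(1)])
qed

lemma exp_integral_parallel_f:
  assumes "x\<^sub>0 \<in> J" "x \<in> J"
    and \<Phi>: "\<And>t. t \<in> J \<Longrightarrow> (\<Phi> has_real_derivative deriv f t / (f t - g t)) (at t)"
  shows "exp (2 * (LBINT t=x\<^sub>0..x.
      deriv (parallel_f a f g) t / (parallel_f a f g t - parallel_g a f g t))) =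
    exp (2 * (LBINT t=x\<^sub>0..x. deriv f t / (f t - g t))) * (1 - a * f x\<^sub>0)\<^sup>2 / (1 - a * f x)\<^sup>2"
proof -
  have nz: "1 - a * f x \<noteq> 0" "1 - a * f x\<^sub>0 \<noteq> 0" using nonfocal assms(1,2) by auto
  have cont: "continuous_on J (\<lambda>t. deriv f t / (f t - g t))"
    using f_diff g_diff fg by (intro continuous_intros differentiable_imp_continuous_on) auto
  have "continuous_on J (\<lambda>t. deriv f t / (f t - g t) + a * deriv f t / (1 - a * f t))"
    using f_diff nonfocal
    by (intro cont continuous_intros differentiable_imp_continuous_on) auto
  then have cont': "continuous_on J
      (\<lambda>t. deriv (parallel_f a f g) t / (parallel_f a f g t - parallel_g a f g t))"
    by (rule continuous_on_eq) (simp add: integrand_parallel_f)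
  have "(LBINT t=x\<^sub>0..x. deriv (parallel_f a f g) t / (parallel_f a f g t - parallel_g a f g t)) =
      \<Phi> x - ln (1 - a * f x) - (\<Phi> x\<^sub>0 - ln (1 - a * f x\<^sub>0))"
    using antiderivative_parallel_f \<Phi>
    by (intro interval_integral_antiderivative[OF connected_J assms(1,2) cont']) auto
  also have "\<dots> = (LBINT t=x\<^sub>0..x. deriv f t / (f t - g t)) + ln (1 - a * f x\<^sub>0) - ln (1 - a * f x)"
    using interval_integral_antiderivative[OF connected_J assms(1,2) cont \<Phi>] by simp
  finally show ?thesis
    using nz by (simp add: exp_double exp_add exp_diff exp_ln_abs power_mult_distrib power_divide)
qed

text \<open>Where f' is nonzero this says that f''/f' - 2 f'/(f - g) is unchanged: f''/f' grows by 2
  a f'/(1 - a f), and the subtracted term grows by exactly twice the shift of the integrand.\<close>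

lemma second_order_coefficient_parallel_f:
  assumes "x \<in> J"
  shows "deriv (deriv (parallel_f a f g)) x -
      2 * (deriv (parallel_f a f g) x)\<^sup>2 / (parallel_f a f g x - parallel_g a f g x) =
    parallel_sign a f g x / (1 - a * f x)\<^sup>2 *
      (deriv (deriv f) x - 2 * (deriv f x)\<^sup>2 / (f x - g x))"
proof -
  define s m d where "s = parallel_sign a f g x" and "m = 1 - a * f x" and "d = f x - g x"
  have nz: "m \<noteq> 0" "d \<noteq> 0"
    using nonfocal[OF assms] fg[OF assms] by (auto simp: m_def d_def)
  have "2 * (deriv (parallel_f a f g) x)\<^sup>2 / (parallel_f a f g x - parallel_g a f g x) =
      2 * deriv (parallel_f a f g) x *
        (deriv (parallel_f a f g) x / (parallel_f a f g x - parallel_g a f g x))"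
    by (simp add: power2_eq_square)
  also have "\<dots> = 2 * (s * deriv f x / m\<^sup>2) * (deriv f x / d + a * deriv f x / m)"
    unfolding integrand_parallel_f[OF assms] unfolding deriv_parallel_f[OF assms] s_def m_def d_def ..
  finally have eq: "2 * (deriv (parallel_f a f g) x)\<^sup>2 / (parallel_f a f g x - parallel_g a f g x) =
    2 * (s * deriv f x / m\<^sup>2) * (deriv f x / d + a * deriv f x / m)" .
  have "s * (deriv (deriv f) x / m\<^sup>2 + 2 * a * (deriv f x)\<^sup>2 / m ^ 3) -
      2 * (s * deriv f x / m\<^sup>2) * (deriv f x / d + a * deriv f x / m) =
    s / m\<^sup>2 * (deriv (deriv f) x - 2 * (deriv f x)\<^sup>2 / d)"
    using nz by (simp add: field_simps power2_eq_square power3_eq_cube)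
  then show ?thesis
    unfolding eq deriv2_parallel_f[OF assms] by (simp only: s_def m_def d_def)
qed

section \<open>The corresponding facts for the second Weingarten function, by symmetry\<close>

lemmas parallel_swap =
  parallel_sign_swap[of a g f] parallel_f_swap[of a g f] parallel_g_swap[of a g f]

lemmas deriv_parallel_g =
  weingarten_functions.deriv_parallel_f[OF swapped, unfolded parallel_swap]
lemmas parallel_g_diff =
  weingarten_functions.parallel_f_diff[OF swapped, unfolded parallel_swap]
lemmas antiderivative_parallel_g =
  weingarten_functions.antiderivative_parallel_f[OF swapped, unfolded parallel_swap]
lemmas exp_integral_parallel_g =
  weingarten_functions.exp_integral_parallel_f[OF swapped, unfolded parallel_swap]
lemmas second_order_coefficient_parallel_g =
  weingarten_functions.second_order_coefficient_parallel_f[OF swapped, unfolded parallel_swap]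

lemma natural_pde_parallel:
  assumes x\<^sub>0: "x\<^sub>0 \<in> J" and hp: "h p \<in> J"
    and \<Phi>: "\<And>t. t \<in> J \<Longrightarrow> (\<Phi> has_real_derivative deriv f t / (f t - g t)) (at t)"
    and \<Psi>: "\<And>t. t \<in> J \<Longrightarrow> (\<Psi> has_real_derivative deriv g t / (g t - f t)) (at t)"
    and \<aa>: "\<aa>'\<^sup>2 * (1 - a * f x\<^sub>0)\<^sup>2 = \<aa>\<^sup>2" and \<bb>: "\<bb>'\<^sup>2 * (1 - a * g x\<^sub>0)\<^sup>2 = \<bb>\<^sup>2"
  shows "natural_pde (parallel_f a f g) (parallel_g a f g) \<aa>' \<bb>' x\<^sub>0 h p =
    parallel_sign a f g (h p) / ((1 - a * f (h p))\<^sup>2 * (1 - a * g (h p))\<^sup>2) *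
      natural_pde f g \<aa> \<bb> x\<^sub>0 h p"
proof -
  define x s m n where "x = h p" and "s = parallel_sign a f g x"
    and "m = 1 - a * f x" and "n = 1 - a * g x"
  note defs = s_def m_def n_def
  have x: "x \<in> J" using hp by (simp add: x_def)
  have nz: "m \<noteq> 0" "n \<noteq> 0" using nonfocal[OF x] by (simp_all add: defs)
  have "s = 1 \<or> s = - 1" using parallel_sign_cases[OF x] by (simp add: s_def)
  \<comment> \<open>The zeroth-order term is a product of three factors, each carrying the sign
    \<open>s\<close>.\<close>
  then have sss: "s * (s * s) = s" by auto
  \<comment> \<open>One computation for both second-order terms: \<open>i\<close> comes from the
    exponential, \<open>j\<close> from the bracket, and \<open>k\<close> is the value at the base
    point that the hypothesis removes. Exchanging \<open>m\<close> and \<open>n\<close> in the roles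
    of \<open>i\<close> and \<open>j\<close> leaves the outer factor the same.\<close>
  have scaled: "c'\<^sup>2 * (e * k\<^sup>2 / i\<^sup>2) * (s * q / j\<^sup>2 * w + s / j\<^sup>2 * r * y) =
      s / (i\<^sup>2 * j\<^sup>2) * (c\<^sup>2 * e * (q * w + r * y))"
    if "c'\<^sup>2 * k\<^sup>2 = c\<^sup>2" for c c' e k i j q w r y :: real
  proof -
    have "c'\<^sup>2 * (e * k\<^sup>2 / i\<^sup>2) * (s * q / j\<^sup>2 * w + s / j\<^sup>2 * r * y) =
      s / (i\<^sup>2 * j\<^sup>2) * ((c'\<^sup>2 * k\<^sup>2) * e * (q * w + r * y))"
      by (simp add: divide_inverse algebra_simps)
    then show ?thesis by (simp only: that)
  qed
  have exps: "exp (2 * (LBINT t=x\<^sub>0..x.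
        deriv (parallel_f a f g) t / (parallel_f a f g t - parallel_g a f g t))) =
      exp (2 * (LBINT t=x\<^sub>0..x. deriv f t / (f t - g t))) * (1 - a * f x\<^sub>0)\<^sup>2 / (1 - a * f x)\<^sup>2"
    "exp (2 * (LBINT t=x\<^sub>0..x.
        deriv (parallel_g a f g) t / (parallel_g a f g t - parallel_f a f g t))) =
      exp (2 * (LBINT t=x\<^sub>0..x. deriv g t / (g t - f t))) * (1 - a * g x\<^sub>0)\<^sup>2 / (1 - a * g x)\<^sup>2"
    using exp_integral_parallel_f[OF x\<^sub>0 x \<Phi>] exp_integral_parallel_g[OF x\<^sub>0 x \<Psi>] by blast+
  have "parallel_f a f g x * parallel_g a f g x * (parallel_f a f g x - parallel_g a f g x) =
      (s * f x / m) * (s * g x / n) * (s * (f x - g x) / (m * n))"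
    unfolding parallel_f_minus_parallel_g[OF x] by (simp add: parallel_f_def parallel_g_def defs)
  also have "\<dots> = (s * (s * s)) / (m\<^sup>2 * n\<^sup>2) * (f x * g x * (f x - g x))"
    by (simp add: divide_inverse power2_eq_square mult_ac)
  finally have last: "parallel_f a f g x * parallel_g a f g x *
      (parallel_f a f g x - parallel_g a f g x) = s / (m\<^sup>2 * n\<^sup>2) * (f x * g x * (f x - g x))"
    by (simp only: sss)
  show ?thesis
    unfolding natural_pde_def Let_def x_def[symmetric]
    unfolding last exps
      second_order_coefficient_parallel_f[OF x] second_order_coefficient_parallel_g[OF x]
    unfolding deriv_parallel_f[OF x] deriv_parallel_g[OF x] defs[symmetric]
    unfolding scaled[OF \<aa>[folded m_def]] scaled[OF \<bb>[folded n_def]]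
    by (simp add: right_diff_distrib mult.commute[of "m\<^sup>2"])
qed

end

section \<open>The natural PDE of a parallel surface\<close>

lemma parallel_weingarten_surface:
  assumes W: "weingarten_surface z D \<nu> f g"
    and C3: "Ck_on 3 z D"
    and D': "open D'" "connected D'" "D' \<subseteq> D"
    and nf: "\<forall>p\<in>D'. (1 - a * curv1 z p) * (1 - a * curv2 z p) \<noteq> 0"
  shows "principal_surface z D"
    and "weingarten_functions a f g (\<nu> ` D')"
    and "weingarten_surface (parallel_surface a z) D' \<nu> (parallel_f a f g) (parallel_g a f g)"
proof -
  show ps: "principal_surface z D"
    using W C3 unfolding weingarten_surface_def regular_surface_def principal_parameters_def
    by unfold_locales auto
  interpret principal_surface z D by (rule ps)
  have curv: "curv1 z p = f (\<nu> p)" "curv2 z p = g (\<nu> p)" if "p \<in> D" for p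
    using W that by (auto simp: weingarten_surface_def)
  have D: "p \<in> D" if "p \<in> D'" for p
    using D'(3) that by blast
  have pos: "curv1 z p - curv2 z p > 0" if "p \<in> D" for p
    using W that unfolding weingarten_surface_def by blast
  have fgJ: "f x - g x \<noteq> 0" "deriv f x * deriv g x \<noteq> 0" if "x \<in> \<nu> ` D'" for x
    using W D'(3) that unfolding weingarten_surface_def by blast+
  have \<nu>: "\<nu> differentiable_on D'" "\<forall>p\<in>D'. (du \<nu> p, dv \<nu> p) \<noteq> (0, 0)"
    using W D'(3) differentiable_on_subset unfolding weingarten_surface_def by blast+
  have J: "\<nu> ` D' \<subseteq> \<nu> ` D" using D' by auto
  have nz: "1 - a * f (\<nu> p) \<noteq> 0" "1 - a * g (\<nu> p) \<noteq> 0" if "p \<in> D'" for p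
    using nf[rule_format, OF that] by (auto simp: curv[OF D[OF that]])
  show wf: "weingarten_functions a f g (\<nu> ` D')"
  proof
    show "open (\<nu> ` D')"
      by (rule open_image_of_nonvanishing_gradient[OF D'(1) \<nu>])
    show "connected (\<nu> ` D')"
      using D' \<nu> by (intro connected_continuous_image differentiable_imp_continuous_on)
    show "f differentiable_on \<nu> ` D'" "deriv f differentiable_on \<nu> ` D'"
      "g differentiable_on \<nu> ` D'" "deriv g differentiable_on \<nu> ` D'"
      using W differentiable_on_subset[OF _ J] unfolding weingarten_surface_def by blast+
    show "f x \<noteq> g x" if "x \<in> \<nu> ` D'" for x
      using fgJ(1)[OF that] by simp
  qed (use nz in blast)+
  interpret weingarten_functions a f g "\<nu> ` D'" by (rule wf)
  note wf_nz = weingarten_functions.nonfocal[OF wf]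
  let ?y = "parallel_surface a z"
  have curv_y: "curv1 ?y p = parallel_f a f g (\<nu> p)" "curv2 ?y p = parallel_g a f g (\<nu> p)"
    if "p \<in> D'" for p
    using curv_parallel_surface[OF D[OF that] nf[rule_format, OF that]]
    by (simp_all add: curv[OF D[OF that]] parallel_f_def parallel_g_def parallel_sign_def)
  show "weingarten_surface ?y D' \<nu> (parallel_f a f g) (parallel_g a f g)"
    unfolding weingarten_surface_def
  proof (intro conjI ballI)
    show "regular_surface ?y D'"
      unfolding regular_surface_def
      using D'(1,2) Ck_on_subset[OF parallel_surface_C2 D'(3)] nf
      by (simp add: cross3_parallel_surface[OF D] regular[OF D])
    show "principal_parameters ?y D'"
      by (simp add: principal_parameters_def fff_parallel_surface[OF D] sff_parallel_surface[OF D])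
    show "\<nu> differentiable_on D'" by (rule \<nu>(1))
    show "(du \<nu> p, dv \<nu> p) \<noteq> (0, 0)" if "p \<in> D'" for p using \<nu>(2) that by blast
    show "parallel_f a f g differentiable_on \<nu> ` D'" "deriv (parallel_f a f g) differentiable_on \<nu> ` D'"
      "parallel_g a f g differentiable_on \<nu> ` D'" "deriv (parallel_g a f g) differentiable_on \<nu> ` D'"
      using parallel_f_diff parallel_g_diff by blast+
    show "curv1 ?y p = parallel_f a f g (\<nu> p)" "curv2 ?y p = parallel_g a f g (\<nu> p)"
      if "p \<in> D'" for p using curv_y that by blast+
    show "curv1 ?y p - curv2 ?y p > 0" if p: "p \<in> D'" for p
    proof -
      define k where "k = (1 - a * f (\<nu> p)) * (1 - a * g (\<nu> p))"
      have "k \<noteq> 0" using nz[OF p] by (simp add: k_def)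
      have "f (\<nu> p) - g (\<nu> p) > 0"
        using pos[OF D[OF p]] by (simp add: curv[OF D[OF p]])
      \<comment> \<open>Here \<open>sgn k / k\<close> is the reciprocal of the absolute value of
        \<open>k\<close>: orienting the parallel surface by \<epsilon> is what preserves the order
        of the principal curvatures.\<close>
      then have "sgn k * (f (\<nu> p) - g (\<nu> p)) / k > 0"
        using \<open>k \<noteq> 0\<close> by (cases "k > 0") (simp_all add: zero_less_divide_iff)
      then show ?thesis
        using parallel_f_minus_parallel_g[of "\<nu> p"] p
        by (simp add: curv_y parallel_sign_def k_def)
    qed
    show "parallel_f a f g x - parallel_g a f g x \<noteq> 0" if x: "x \<in> \<nu> ` D'" for x
      using parallel_sign_cases[OF x] wf_nz[OF x] fgJ(1)[OF x]
      by (auto simp: parallel_f_minus_parallel_g[OF x])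
    show "deriv (parallel_f a f g) x * deriv (parallel_g a f g) x \<noteq> 0" if x: "x \<in> \<nu> ` D'" for x
    proof -
      have "deriv f x * deriv g x \<noteq> 0"
        by (rule fgJ(2)[OF x])
      then show ?thesis
        using parallel_sign_cases[OF x] wf_nz[OF x]
        by (auto simp: deriv_parallel_f[OF x] deriv_parallel_g[OF x])
    qed
  qed
qed

text \<open>Removing the focal points may disconnect \<open>D\<close>, hence the connected subdomain
  \<open>D'\<close>, on which \<epsilon> is constant. The equivalence holds pointwise, for any
  unknown whose value lies in \<nu>(D').\<close>

theorem theorem3p2:
  fixes z :: "real \<times> real \<Rightarrow> real^3" and D D' :: "(real \<times> real) set"
    and \<nu> :: "real \<times> real \<Rightarrow> real" and f g :: "real \<Rightarrow> real" and a :: real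
  assumes "weingarten_surface z D \<nu> f g"
    and "natural_parameters z D \<nu> f g"
    and "Ck_on 3 z D"
    and "a \<noteq> 0"
    and "open D'" and "connected D'" and "D' \<subseteq> D"
    and "\<forall>p\<in>D'. (1 - a * curv1 z p) * (1 - a * curv2 z p) \<noteq> 0"
  shows "weingarten_surface (parallel_surface a z) D' \<nu> (parallel_f a f g) (parallel_g a f g) \<and>
     natural_parameters (parallel_surface a z) D' \<nu> (parallel_f a f g) (parallel_g a f g) \<and>
     (\<forall>p\<^sub>0\<in>D'. \<forall>\<aa> \<bb> \<aa>' \<bb>'.
        \<aa> \<noteq> 0 \<and> \<bb> \<noteq> 0 \<and> \<aa>' \<noteq> 0 \<and> \<bb>' \<noteq> 0 \<and>
        \<aa>\<^sup>2 * fff_E z p\<^sub>0 = 1 \<and> \<bb>\<^sup>2 * fff_G z p\<^sub>0 = 1 \<and>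
        \<aa>'\<^sup>2 * fff_E (parallel_surface a z) p\<^sub>0 = 1 \<and> \<bb>'\<^sup>2 * fff_G (parallel_surface a z) p\<^sub>0 = 1 \<longrightarrow>
        pdes_coincide (\<nu> ` D')
          (natural_pde (parallel_f a f g) (parallel_g a f g) \<aa>' \<bb>' (\<nu> p\<^sub>0))
          (natural_pde f g \<aa> \<bb> (\<nu> p\<^sub>0)))"
proof (intro conjI ballI allI impI)
  note parallel = parallel_weingarten_surface[OF assms(1,3,5-8)]
  show "weingarten_surface (parallel_surface a z) D' \<nu> (parallel_f a f g) (parallel_g a f g)"
    by (rule parallel(3))
  interpret principal_surface z D by (rule parallel(1))
  interpret weingarten_functions a f g "\<nu> ` D'" by (rule parallel(2))
  have curv: "curv1 z p = f (\<nu> p)" "curv2 z p = g (\<nu> p)" if "p \<in> D" for p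
    using assms(1) that by (auto simp: weingarten_surface_def)
  have J: "\<nu> ` D' \<subseteq> \<nu> ` D" using assms(7) by auto
  from assms(2) obtain \<Phi> \<Psi> c d where nat:
    "\<forall>x\<in>\<nu> ` D. (\<Phi> has_real_derivative deriv f x / (f x - g x)) (at x)"
    "\<forall>x\<in>\<nu> ` D. (\<Psi> has_real_derivative deriv g x / (g x - f x)) (at x)"
    "\<forall>p\<in>D. sqrt (fff_E z p) * exp (\<Phi> (\<nu> p)) = c"
    "\<forall>p\<in>D. sqrt (fff_G z p) * exp (\<Psi> (\<nu> p)) = d"
    unfolding natural_parameters_def by (elim exE conjE)
  have \<Phi>: "(\<Phi> has_real_derivative deriv f x / (f x - g x)) (at x)"
    and \<Psi>: "(\<Psi> has_real_derivative deriv g x / (g x - f x)) (at x)" if "x \<in> \<nu> ` D'" for x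
    using nat(1,2) that J by blast+
  show "natural_parameters (parallel_surface a z) D' \<nu> (parallel_f a f g) (parallel_g a f g)"
    unfolding natural_parameters_def
  proof (intro exI conjI ballI)
    fix x assume x: "x \<in> \<nu> ` D'"
    show "((\<lambda>x. \<Phi> x - ln (1 - a * f x)) has_real_derivative
        deriv (parallel_f a f g) x / (parallel_f a f g x - parallel_g a f g x)) (at x)"
      by (rule antiderivative_parallel_f[OF x \<Phi>[OF x]])
    show "((\<lambda>x. \<Psi> x - ln (1 - a * g x)) has_real_derivative
        deriv (parallel_g a f g) x / (parallel_g a f g x - parallel_f a f g x)) (at x)"
      by (rule antiderivative_parallel_g[OF x \<Psi>[OF x]])
  next
    fix p assume p: "p \<in> D'"
    then have "p \<in> D" using assms(7) by blast
    have "1 - a * f (\<nu> p) \<noteq> 0" "1 - a * g (\<nu> p) \<noteq> 0"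
      using nonfocal p by blast+
    \<comment> \<open>The root gains the absolute value of 1 - a f (or 1 - a g) and the exponential
      loses it, so even the constants \<open>c\<close> and \<open>d\<close> are those of the
      original surface.\<close>
    then show "sqrt (fff_E (parallel_surface a z) p) * exp (\<Phi> (\<nu> p) - ln (1 - a * f (\<nu> p))) = c"
      "sqrt (fff_G (parallel_surface a z) p) * exp (\<Psi> (\<nu> p) - ln (1 - a * g (\<nu> p))) = d"
      using nat(3,4)[rule_format, OF \<open>p \<in> D\<close>]
      by (simp_all add: exp_diff fff_parallel_surface[OF \<open>p \<in> D\<close>] curv[OF \<open>p \<in> D\<close>] real_sqrt_mult exp_ln_abs)
  qed
  fix p\<^sub>0 \<aa> \<bb> \<aa>' \<bb>'
  assume p\<^sub>0: "p\<^sub>0 \<in> D'" and ab: "\<aa> \<noteq> 0 \<and> \<bb> \<noteq> 0 \<and> \<aa>' \<noteq> 0 \<and> \<bb>' \<noteq> 0 \<and>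
    \<aa>\<^sup>2 * fff_E z p\<^sub>0 = 1 \<and> \<bb>\<^sup>2 * fff_G z p\<^sub>0 = 1 \<and>
    \<aa>'\<^sup>2 * fff_E (parallel_surface a z) p\<^sub>0 = 1 \<and> \<bb>'\<^sup>2 * fff_G (parallel_surface a z) p\<^sub>0 = 1"
  have "p\<^sub>0 \<in> D" using p\<^sub>0 assms(7) by blast
  \<comment> \<open>Both sides equal 1 by the two normalisations at the base point; cancelling the
    positive coefficients of the first form leaves the ratios.\<close>
  have "(\<aa>'\<^sup>2 * (1 - a * f (\<nu> p\<^sub>0))\<^sup>2) * fff_E z p\<^sub>0 = \<aa>\<^sup>2 * fff_E z p\<^sub>0"
    "(\<bb>'\<^sup>2 * (1 - a * g (\<nu> p\<^sub>0))\<^sup>2) * fff_G z p\<^sub>0 = \<bb>\<^sup>2 * fff_G z p\<^sub>0"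
    using ab by (simp_all add: fff_parallel_surface[OF \<open>p\<^sub>0 \<in> D\<close>] curv[OF \<open>p\<^sub>0 \<in> D\<close>] mult.assoc)
  then have ratios: "\<aa>'\<^sup>2 * (1 - a * f (\<nu> p\<^sub>0))\<^sup>2 = \<aa>\<^sup>2" "\<bb>'\<^sup>2 * (1 - a * g (\<nu> p\<^sub>0))\<^sup>2 = \<bb>\<^sup>2"
    using fff_E_pos[OF regular[OF \<open>p\<^sub>0 \<in> D\<close>]] fff_G_pos[OF regular[OF \<open>p\<^sub>0 \<in> D\<close>]] by simp_all
  have "natural_pde (parallel_f a f g) (parallel_g a f g) \<aa>' \<bb>' (\<nu> p\<^sub>0) h p = 0 \<longleftrightarrow>
      natural_pde f g \<aa> \<bb> (\<nu> p\<^sub>0) h p = 0" if "h p \<in> \<nu> ` D'" for h p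
  proof -
    have "natural_pde (parallel_f a f g) (parallel_g a f g) \<aa>' \<bb>' (\<nu> p\<^sub>0) h p =
      parallel_sign a f g (h p) / ((1 - a * f (h p))\<^sup>2 * (1 - a * g (h p))\<^sup>2) *
        natural_pde f g \<aa> \<bb> (\<nu> p\<^sub>0) h p"
      using p\<^sub>0 that \<Phi> \<Psi> ratios by (intro natural_pde_parallel) auto
    moreover have "parallel_sign a f g (h p) / ((1 - a * f (h p))\<^sup>2 * (1 - a * g (h p))\<^sup>2) \<noteq> 0"
      using parallel_sign_cases[OF that] nonfocal[OF that] by auto
    ultimately show ?thesis by simp
  qed
  then show "pdes_coincide (\<nu> ` D')
      (natural_pde (parallel_f a f g) (parallel_g a f g) \<aa>' \<bb>' (\<nu> p\<^sub>0))
      (natural_pde f g \<aa> \<bb> (\<nu> p\<^sub>0))"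
    unfolding pdes_coincide_def by (metis image_subset_iff)
qed

end
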